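(* Let $V$ be a vertex algebra, $g$ an automorphism of $V$ of finite order $T$, $(W,Y_W)$ a $g$-twisted $\phi$-coordinated $V$-module and $n\in(1/T)\mathbb N$. Then $\tilde\Omega_n(W)$ is invariant under $o(v)$ for all $v\in V$, and it is an $\tilde A_{g,n}(V)$-module with $v+\tilde O_{g,n}(V)$ acting as $o(v)$.
   Context: $V$ is a vertex algebra with vacuum $\mathbf 1$, $Y(v,x)=\sum_kv_kx^{-k-1}$, $\mathcal Dv=v_{-2}\mathbf 1$; $g^T=1$; $V=\bigoplus_{r=0}^{T-1}V^r$, $V^r=\{v: gv=e^{-2\pi\sqrt{-1}r/T}v\}$. A $g$-twisted $\phi$-coordinated $V$-module is a vector space $W$ with a linear map $Y_W(\cdot,x):V\to\mathrm{Hom}(W,W((x^{1/T})))$, $Y_W(v,x)=\sum_{n\in(1/T)\mathbb Z}v_nx^{-n-1}$, such that: (i) $Y_W(\mathbf 1,x)=\mathrm{id}_W$; (ii) $Y_W(gv,x)=\lim_{x^{1/T}\to\omega_T^{-1}x^{1/T}}Y_W(v,x)$, $\omega_T=e^{-2\pi\sqrt{-1}/T}$; (iii) for $u,v$ there is $k\in\mathbb N$ with $(x_1-x_2)^kY_W(u,x_1)Y_W(v,x_2)\in\mathrm{Hom}(W,W((x_1^{1/T},x_2^{1/T})))$ and $x_2^k(e^{x_0}-1)^kY_W(Y(u,x_0)v,x_2)=\big((x_1-x_2)^kY_W(u,x_1)Y_W(v,x_2)\big)|_{x_1^{1/T}=(x_2e^{x_0})^{1/T}}$. $o_i(u)=u_{-i-1}$,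 $o(u)=o_0(u)=u_{-1}$; $\tilde\Omega_n(W)=\{w: o_k(v)w=0\ \forall v\in V,\ k\in(1/T)\mathbb Z,\ k<-n\}$. For $k,l\in\{0,\dots,T-1\}$, $\delta_k(l)=1$ if $k\ge l$, $0$ if $k<l$, $\delta_k(T)=0$; $n=\lfloor n\rfloor+\bar n/T$, $\bar n\in\{0,\dots,T-1\}$. $(1+y)^\alpha$ expanded in nonnegative powers of $y$; $Y(u,\log(1+y))v$ is $Y(u,x)v$ at $x=\log(1+y)$. For $u\in V^r$, $v\in V$: $u\bullet_{g,n}v=\sum_{i=0}^{\lfloor n\rfloor}(-1)^i\binom{\lfloor n\rfloor+i}{i}\operatorname{Res}_y\frac{(1+y)^{-1+\lfloor n\rfloor+\delta_{\bar n}(r)+r/T}}{y^{\lfloor n\rfloor+i+1}}Y(u,\log(1+y))v$ if $r=0$ and $u\bullet_{g,n}v=0$ if $r\neq0$; $u\diamond_{g,n}v=\operatorname{Res}_y\frac{(1+y)^{-1+\delta_{\bar n}(r)+\lfloor n\rfloor+r/T}}{y^{2\lfloor n\rfloor+\delta_{\bar n}(r)+\delta_{\bar n}(T-r)+1}}Y(u,\log(1+y))v$. $\tilde O_{g,n}(V)=\mathrm{span}\{u\diamond_{g,n}v:u,v\in V\}+\mathcal D V$, and $\tilde A_{g,n}(V)=V/\tilde O_{g,n}(V)$ is an associative algebra with product induced by $\bullet_{g,n}$ and unit $\mathbf 1+\tilde O_{g,n}(V)$. *)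

theory Defs
  imports "HOL-Analysis.Analysis" "HOL-Computational_Algebra.Formal_Laurent_Series"
begin

(* Sum of a family with (assumed) finite support: the sum of its nonzero terms.
   Used to render the formally infinite sums of the paper, which have only
   finitely many nonzero terms under the truncation axioms. *)
definition supp_sum :: "('i \<Rightarrow> 'a::comm_monoid_add) \<Rightarrow> 'a" where
  "supp_sum f = sum f {i. f i \<noteq> 0}"

(* Vertex algebra over \<complex>: sc = scalar multiplication, Y u n v = u_n v, vac = vacuum.
   Axioms: linearity, truncation, vacuum, creation, Jacobi identity (in Borcherds
   component form). *)
definition vertex_algebra ::
  "(complex \<Rightarrow> 'v::ab_group_add \<Rightarrow> 'v) \<Rightarrow> ('v \<Rightarrow> int \<Rightarrow> 'v \<Rightarrow> 'v) \<Rightarrow> 'v \<Rightarrow> bool" where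
  "vertex_algebra sc Y vac \<longleftrightarrow>
     vector_space sc \<and>
     (\<forall>u n. Vector_Spaces.linear sc sc (Y u n)) \<and>
     (\<forall>n v. Vector_Spaces.linear sc sc (\<lambda>u. Y u n v)) \<and>
     (\<forall>u v. \<exists>N. \<forall>n\<ge>N. Y u n v = 0) \<and>
     (\<forall>n v. Y vac n v = (if n = -1 then v else 0)) \<and>
     (\<forall>u n. n \<ge> 0 \<longrightarrow> Y u n vac = 0) \<and>
     (\<forall>u. Y u (-1) vac = u) \<and>
     (\<forall>u v w l m n.
        supp_sum (\<lambda>i::nat. sc ((of_int m :: complex) gchoose i) (Y (Y u (l + int i) v) (m + n - int i) w))
      = supp_sum (\<lambda>i::nat. sc ((-1) ^ i * ((of_int l :: complex) gchoose i))
            (Y u (l + m - int i) (Y v (n + int i) w)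
             - sc ((-1::complex) powi l) (Y v (l + n - int i) (Y u (m + int i) w)))))"

definition va_automorphism ::
  "(complex \<Rightarrow> 'v::ab_group_add \<Rightarrow> 'v) \<Rightarrow> ('v \<Rightarrow> int \<Rightarrow> 'v \<Rightarrow> 'v) \<Rightarrow> 'v \<Rightarrow> ('v \<Rightarrow> 'v) \<Rightarrow> bool" where
  "va_automorphism sc Y vac g \<longleftrightarrow>
     Vector_Spaces.linear sc sc g \<and> bij g \<and> g vac = vac \<and>
     (\<forall>u n v. g (Y u n v) = Y (g u) n (g v))"

definition eigsp ::
  "(complex \<Rightarrow> 'v \<Rightarrow> 'v) \<Rightarrow> ('v \<Rightarrow> 'v) \<Rightarrow> nat \<Rightarrow> nat \<Rightarrow> 'v set" where
  "eigsp sc g T r = {v. g v = sc (exp (- 2 * pi * \<i> * of_nat r / of_nat T)) v}"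

definition omegaT :: "nat \<Rightarrow> complex" where
  "omegaT T = exp (- 2 * pi * \<i> / of_nat T)"

(* coefficient of x0^j in (e^{x0}-1)^k *)
definition expm1_pow_coeff :: "nat \<Rightarrow> nat \<Rightarrow> complex" where
  "expm1_pow_coeff k j = (\<Sum>i\<le>k. of_nat (k choose i) * (-1) ^ (k - i) * of_nat i ^ j) / fact j"

(* g-twisted phi-coordinated module.  YW v m w = v_{m/T} w, i.e.
   Y_W(v,x) = sum_m (YW v m) x^{-m/T-1}.  In (iii), Q a b is the coefficient of
   x1^{a/T} x2^{b/T} in (x1-x2)^k Y_W(u,x1)Y_W(v,x2)w. *)
definition twisted_phi_module ::
  "(complex \<Rightarrow> 'v::ab_group_add \<Rightarrow> 'v) \<Rightarrow> ('v \<Rightarrow> int \<Rightarrow> 'v \<Rightarrow> 'v) \<Rightarrow> 'v \<Rightarrow> ('v \<Rightarrow> 'v) \<Rightarrow> nat \<Rightarrow>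
   (complex \<Rightarrow> 'w::ab_group_add \<Rightarrow> 'w) \<Rightarrow> ('v \<Rightarrow> int \<Rightarrow> 'w \<Rightarrow> 'w) \<Rightarrow> bool" where
  "twisted_phi_module sc Y vac g T scW YW \<longleftrightarrow>
     vector_space scW \<and>
     (\<forall>v m. Vector_Spaces.linear scW scW (YW v m)) \<and>
     (\<forall>m w. Vector_Spaces.linear sc scW (\<lambda>v. YW v m w)) \<and>
     (\<forall>v w. \<exists>N. \<forall>m\<ge>N. YW v m w = 0) \<and>
     (\<forall>m w. YW vac m w = (if m = - int T then w else 0)) \<and>
     (\<forall>v m w. YW (g v) m w = scW (omegaT T powi m) (YW v m w)) \<and>
     (\<forall>u v. \<exists>k::nat. \<forall>w.
        (let P = (\<lambda>a b. YW u (- a - int T) (YW v (- b - int T) w));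
             Q = (\<lambda>a b. \<Sum>j\<le>k. scW ((-1) ^ j * of_nat (k choose j))
                          (P (a - int T * int (k - j)) (b - int T * int j)))
         in (\<exists>N. \<forall>a b. (a < N \<or> b < N) \<longrightarrow> Q a b = 0) \<and>
            (\<forall>(m::int) (c::int).
               supp_sum (\<lambda>n::int. scW (if m + n + 1 \<ge> 0 then expm1_pow_coeff k (nat (m + n + 1)) else 0)
                                      (YW (Y u n v) (int T * int k - c - int T) w))
             = (if m < 0 then 0 else
                  supp_sum (\<lambda>a::int. scW ((of_int a / of_nat T) ^ nat m / fact (nat m)) (Q a (c - a)))))))"

(* Res_y (1+y)^alpha / y^P * Y(u, log(1+y)) v *)
definition res_coeff :: "complex \<Rightarrow> int \<Rightarrow> int \<Rightarrow> complex" where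
  "res_coeff \<alpha> P j = fls_nth (fps_to_fls (fps_binomial \<alpha>) * fls_X_intpow (- P)
                        * (fps_to_fls (fps_ln 1)) powi (- j - 1)) (-1)"

definition resY :: "(complex \<Rightarrow> 'v \<Rightarrow> 'v) \<Rightarrow> ('v \<Rightarrow> int \<Rightarrow> 'v \<Rightarrow> 'v) \<Rightarrow> complex \<Rightarrow> int \<Rightarrow> 'v \<Rightarrow> 'v \<Rightarrow> 'v::ab_group_add" where
  "resY sc Y \<alpha> P u v = supp_sum (\<lambda>j::int. sc (res_coeff \<alpha> P j) (Y u j v))"

definition deltaT :: "nat \<Rightarrow> nat \<Rightarrow> nat \<Rightarrow> int" where
  "deltaT T k l = (if l = T then 0 else if k \<ge> l then 1 else 0)"

(* n = nn / T;  floor n = nn div T, nbar = nn mod T.  u in V^r. *)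
definition bulletg ::
  "(complex \<Rightarrow> 'v \<Rightarrow> 'v) \<Rightarrow> ('v \<Rightarrow> int \<Rightarrow> 'v \<Rightarrow> 'v) \<Rightarrow> nat \<Rightarrow> nat \<Rightarrow> nat \<Rightarrow> 'v \<Rightarrow> 'v \<Rightarrow> 'v::ab_group_add" where
  "bulletg sc Y T nn r u v =
     (if r = 0 then
        (\<Sum>i\<le>nn div T. sc ((-1) ^ i * of_nat ((nn div T + i) choose i))
            (resY sc Y (-1 + of_nat (nn div T) + of_int (deltaT T (nn mod T) r) + of_nat r / of_nat T)
                  (int (nn div T) + int i + 1) u v))
      else 0)"

definition diamondg ::
  "(complex \<Rightarrow> 'v \<Rightarrow> 'v) \<Rightarrow> ('v \<Rightarrow> int \<Rightarrow> 'v \<Rightarrow> 'v) \<Rightarrow> nat \<Rightarrow> nat \<Rightarrow> nat \<Rightarrow> 'v \<Rightarrow> 'v \<Rightarrow> 'v::ab_group_add" where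
  "diamondg sc Y T nn r u v =
     resY sc Y (-1 + of_int (deltaT T (nn mod T) r) + of_nat (nn div T) + of_nat r / of_nat T)
          (2 * int (nn div T) + deltaT T (nn mod T) r + deltaT T (nn mod T) (T - r) + 1) u v"

definition Otilde ::
  "(complex \<Rightarrow> 'v \<Rightarrow> 'v) \<Rightarrow> ('v \<Rightarrow> int \<Rightarrow> 'v \<Rightarrow> 'v) \<Rightarrow> 'v \<Rightarrow> ('v \<Rightarrow> 'v) \<Rightarrow> nat \<Rightarrow> nat \<Rightarrow> 'v::ab_group_add set" where
  "Otilde sc Y vac g T nn = module.span sc
     ({diamondg sc Y T nn r u v | r u v. r < T \<and> u \<in> eigsp sc g T r} \<union> {Y v (-2) vac | v. True})"

(* o_k(v) with k = kk/T: o_k(v) = v_{-k-1} = YW v (-kk - T) *)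
definition o_op :: "nat \<Rightarrow> ('v \<Rightarrow> int \<Rightarrow> 'w \<Rightarrow> 'w) \<Rightarrow> int \<Rightarrow> 'v \<Rightarrow> 'w \<Rightarrow> 'w" where
  "o_op T YW kk v = YW v (- kk - int T)"

definition Omega_tilde :: "nat \<Rightarrow> ('v \<Rightarrow> int \<Rightarrow> 'w \<Rightarrow> 'w::zero) \<Rightarrow> nat \<Rightarrow> 'w set" where
  "Omega_tilde T YW nn = {w. \<forall>v kk. kk < - int nn \<longrightarrow> o_op T YW kk v w = 0}"

end

theory Submission
  imports Defs
begin

text \<open>
  Write \<open>P\<close> for the series \<open>Y\<^sub>W(u,x\<^sub>1)Y\<^sub>W(v,x\<^sub>2)w\<close> with \<open>w \<in> \<Omega>\<^sub>n(W)\<close> and put \<open>Q = (x\<^sub>1-x\<^sub>2)\<^sup>k P\<close>. Pairing the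
  associativity axiom with scalar Laurent series in \<open>x\<^sub>0\<close> and substituting \<open>y = e\<^sup>x - 1\<close> gives
  \<open>o(Res\<^sub>y (1+y)\<^sup>\<alpha> y\<^sup>-\<^sup>p Y(u,log(1+y))v) w = \<Sum>\<^sub>a binom(\<alpha> + a/T, p+k-1) Q(a, Tk-a)\<close>, where \<open>Q(a,b)\<close> is the
  coefficient of \<open>x\<^sub>1\<^bsup>a/T\<^esup> x\<^sub>2\<^bsup>b/T\<^esup>\<close>. Skew symmetry of \<open>V\<close> together with \<open>Y\<^sub>W(\<D>v,x) = x d/dx Y\<^sub>W(v,x)\<close> and the linear
  independence of exponentials yields weak commutativity, so that \<open>Q\<close> has no exponent below \<open>-n\<close> in
  either variable. On the remaining finite range every binomial coefficient occurring for \<open>u \<diamondop> v\<close>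
  vanishes, and those occurring for \<open>u \<bullet> v\<close> combine by Vandermonde's identity to the expansion of
  \<open>(x\<^sub>1-x\<^sub>2)\<^sup>-\<^sup>k\<close>, leaving the constant coefficient \<open>o(u)o(v)w\<close> of \<open>P\<close>. Invariance holds because the iterate
  side vanishes in degrees below \<open>-n\<close>.
\<close>

section \<open>Formal Laurent series\<close>

text \<open>Only finitely many coefficients lie below \<open>N\<close>; removing the lowest monomial
  one at a time leaves a series of order at least \<open>N\<close>.\<close>

lemma fls_prpart_induct:
  fixes F :: "'a::comm_ring_1 fls"
  assumes small: "\<And>F. (\<forall>i<N. fls_nth F i = 0) \<Longrightarrow> Q F"
    and monom: "\<And>c i. Q (fls_const c * fls_X_intpow i)"
    and add: "\<And>F G. Q F \<Longrightarrow> Q G \<Longrightarrow> Q (F + G)"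
  shows "Q F"
proof -
  have *: "Q F" if "\<forall>i<N - int s. fls_nth F i = 0" for s F
    using that
  proof (induction s arbitrary: F)
    case 0
    then show ?case using small by simp
  next
    case (Suc s)
    define m where "m = N - int (Suc s)"
    define M where "M = fls_const (fls_nth F m) * fls_X_intpow m"
    have nth_M: "fls_nth M i = (if i = m then fls_nth F m else 0)" for i
      by (simp add: M_def)
    have "\<forall>i<N - int s. fls_nth (F - M) i = 0"
      using Suc.prems by (auto simp: nth_M m_def)
    hence "Q (F - M)" by (rule Suc.IH)
    moreover have "Q M" unfolding M_def by (rule monom)
    ultimately have "Q ((F - M) + M)" by (rule add)
    then show ?case by simp
  qed
  show ?thesis
    by (rule *[of "nat (N - fls_subdegree F)"]) auto
qed

lemma fls_deriv_power_int:
  fixes F :: "'a::field fls"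
  assumes "F \<noteq> 0"
  shows "fls_deriv (F powi n) = of_int n * F powi (n - 1) * fls_deriv F"
proof (cases "n \<ge> 0")
  case True
  then obtain k where n: "n = int k" by (metis nonneg_int_cases)
  have "of_nat k * F ^ (k - 1) = of_int n * F powi (n - 1)"
    by (cases k) (auto simp: n)
  then show ?thesis
    using fls_deriv_power[of F k] by (simp add: n)
next
  case False
  then obtain k where n: "n = - int k" "k > 0"
    by (metis neg_int_cases not_le)
  have "fls_deriv (F powi n) = - (of_nat k * F ^ (k - 1) * fls_deriv F) / (F ^ k)\<^sup>2"
    using assms
    by (simp add: n power_int_minus fls_inverse_deriv fls_deriv_power divide_inverse power_inverse
        mult_ac)
  also have "\<dots> = of_int n * F powi (n - 1) * fls_deriv F"
  proof -
    have "n - 1 = - int (Suc k)" by (simp add: n)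
    hence eq: "F powi (n - 1) = inverse (F ^ Suc k)"
      by (simp only: power_int_minus power_int_of_nat)
    obtain l where "k = Suc l" using n by (cases k) auto
    then show ?thesis
      unfolding eq using assms by (simp add: n(1) field_simps power2_eq_square)
  qed
  finally show ?thesis .
qed

text \<open>By linearity only monomials matter: \<open>G^i G'\<close> is a multiple of the
  derivative of \<open>G^(i+1)\<close> unless \<open>i = -1\<close>, and \<open>G'/G\<close> has the
  order of \<open>G\<close> as residue. Power series have no residue on either side.\<close>

lemma fls_residue_compose_fps:
  fixes F :: "'a::field_char_0 fls"
  assumes [simp]: "G \<noteq> 0" "fps_nth G 0 = 0"
  shows "fls_residue (fls_compose_fps F G * fls_deriv (fps_to_fls G))
    = of_nat (subdegree G) * fls_residue F"
proof (induction F rule: fls_prpart_induct[where N = 0])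
  case (1 F)
  define f where "f = fls_regpart F"
  have F: "F = fps_to_fls f"
    using 1 by (auto simp: fls_eq_iff f_def)
  show ?case
    by (simp add: F fls_deriv_fps_to_fls flip: fls_times_fps_to_fls)
next
  case (2 c i)
  let ?G = "fps_to_fls G"
  have comp: "fls_compose_fps (fls_const c * fls_X_intpow i) G = fls_const c * ?G powi i"
    by (simp add: fls_compose_fps_mult fls_compose_fps_shift)
  show ?case
  proof (cases "i = -1")
    case True
    have "fls_residue (inverse ?G * fls_deriv ?G) = of_int (fls_subdegree ?G)"
      by (rule fls_residue_deriv_times_inverse_eq_subdegree)
    then show ?thesis
      unfolding comp
      by (simp add: True fls_subdegree_fls_to_fps mult.assoc)
  next
    case False
    have "fls_deriv (?G powi (i + 1)) = of_int (i + 1) * (?G powi i * fls_deriv ?G)"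
      by (subst fls_deriv_power_int) (auto simp: mult.assoc)
    hence "fls_residue (of_int (i + 1) * (?G powi i * fls_deriv ?G)) = 0"
      by (metis fls_residue_deriv)
    hence "of_int (i + 1) * fls_residue (?G powi i * fls_deriv ?G) = 0"
      by (simp only: fls_residue_of_int_times)
    moreover have "(of_int (i + 1) :: 'a) \<noteq> 0"
      using False by (metis add.commute add_eq_0_iff of_int_eq_0_iff)
    ultimately have "fls_residue (?G powi i * fls_deriv ?G) = 0" by simp
    then show ?thesis
      using False by (simp add: comp mult.assoc)
  qed
next
  case (3 F G)
  then show ?case by (simp add: fls_compose_fps_add algebra_simps)
qed

section \<open>Exponential series and the substitution \<open>y = e^x - 1\<close>\<close>

text \<open>Composing \<open>(1 + X) f' = c f\<close> with \<open>e^X - 1\<close> shows by the chain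
  rule that the left side solves \<open>a' = c a\<close> with constant term 1.\<close>

lemma fps_binomial_compose_exp:
  "fps_binomial c oo (fps_exp 1 - 1) = fps_exp (c::'a::field_char_0)"
proof -
  let ?G = "fps_exp 1 - 1 :: 'a fps"
  let ?a = "fps_binomial c oo ?G"
  have [simp]: "fps_nth ?G 0 = 0" by simp
  have E: "(1 + fps_X) oo ?G = fps_exp (1::'a)"
    by (simp add: fps_compose_add_distrib)
  have "(1 + fps_X) * fps_deriv (fps_binomial c) = fps_const c * fps_binomial c"
    unfolding fps_binomial_deriv by (simp add: fps_divide_unit inverse_mult_eq_1' mult_ac)
  hence "((1 + fps_X) * fps_deriv (fps_binomial c)) oo ?G = (fps_const c * fps_binomial c) oo ?G"
    by simp
  hence "fps_exp 1 * (fps_deriv (fps_binomial c) oo ?G) = fps_const c * ?a"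
    by (simp add: fps_compose_mult_distrib E)
  hence "fps_deriv ?a = fps_const c * ?a"
    by (simp add: fps_compose_deriv mult.commute)
  hence "?a = fps_const (fps_nth ?a 0) * fps_exp c"
    by (simp only: fps_exp_unique_ODE)
  then show ?thesis by simp
qed

abbreviation fls_exp :: "complex \<Rightarrow> complex fls" where
  "fls_exp c \<equiv> fps_to_fls (fps_exp c)"

lemma fls_exp_add: "fls_exp (a + b) = fls_exp a * fls_exp b"
  by (simp add: fps_exp_add_mult fls_times_fps_to_fls)

lemma fls_exp_minus_1_nonzero [simp]: "fls_exp 1 - 1 \<noteq> 0"
proof -
  have "fls_nth (fls_exp 1 - 1) 1 \<noteq> 0" by simp
  thus ?thesis by (metis fls_zero_nth)
qed

text \<open>Substituting \<open>y = e\<^sup>x - 1\<close> turns residues in \<open>y\<close> into coefficients in \<open>x\<close>.\<close>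

lemma res_coeff_conv_exp:
  "res_coeff \<alpha> P j = fls_nth (fls_exp (\<alpha> + 1) * (fls_exp 1 - 1) powi (- P)) j"
proof -
  define G where "G = (fps_exp 1 - 1 :: complex fps)"
  have G0: "fps_nth G 0 = 0" and G1: "fps_nth G 1 = 1" by (simp_all add: G_def)
  have Gnz: "G \<noteq> 0" using G1 by auto
  have sub: "subdegree G = 1"
    by (rule subdegreeI) (use G0 G1 in auto)
  have ln: "fps_ln 1 oo G = fps_X"
    using fps_inv[of G] G0 G1 fps_ln_fps_exp_inv[of "1::complex"] by (simp add: G_def)
  define F where "F = fps_to_fls (fps_binomial \<alpha>) * fls_X_intpow (- P) * (fps_to_fls (fps_ln 1)) powi (- j - 1)"
  have toG: "fps_to_fls G = fls_exp 1 - 1" by (simp add: G_def)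
  have "fls_compose_fps F G = fls_exp \<alpha> * fps_to_fls G powi (-P) * fls_X powi (- j - 1)"
    unfolding F_def
    using fps_binomial_compose_exp[of \<alpha>, folded G_def]
    by (simp add: fls_compose_fps_mult fls_compose_fps_powi fls_compose_fps_shift Gnz G0 ln)
  \<comment> \<open>The Jacobian \<open>e^x\<close> shifts \<open>\<alpha>\<close> to
    \<open>\<alpha> + 1\<close>, while \<open>ln (1 + y)\<close> has become \<open>x\<close>, whose
    power \<open>-j - 1\<close> selects coefficient \<open>j\<close>.\<close>
  moreover have "fls_deriv (fps_to_fls G) = fls_exp 1"
    by (simp add: fls_deriv_fps_to_fls G_def)
  moreover have "res_coeff \<alpha> P j = fls_residue (fls_compose_fps F G * fls_deriv (fps_to_fls G))"
    by (subst fls_residue_compose_fps) (use Gnz G0 sub in \<open>auto simp: res_coeff_def F_def\<close>)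
  ultimately have "res_coeff \<alpha> P j =
     fls_residue (fls_exp \<alpha> * fps_to_fls G powi (-P) * fls_X powi (- j - 1) * fls_exp 1)"
    by simp
  also have "fls_exp \<alpha> * fps_to_fls G powi (-P) * fls_X powi (- j - 1) * fls_exp 1 =
      fls_X_intpow (- j - 1) * (fls_exp (\<alpha> + 1) * (fls_exp 1 - 1) powi (- P))"
    by (simp add: fls_exp_add toG mult_ac del: fls_X_power_int) simp
  finally show ?thesis
    by (simp add: fls_shifted_times_simps)
qed

text \<open>This is \<open>res_coeff\<close> at \<open>j = -1\<close>, where the logarithm has
  exponent 0 and a coefficient of \<open>(1 + y)^c\<close> remains.\<close>

lemma fls_residue_exp_div_power:
  "fls_residue (fls_exp (c + 1) * (fls_exp 1 - 1) powi (- (int p + 1))) = c gchoose p"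
proof -
  have "fls_residue (fls_exp (c + 1) * (fls_exp 1 - 1) powi (- (int p + 1)))
    = res_coeff c (int p + 1) (- 1)"
    by (simp add: res_coeff_conv_exp)
  also have "\<dots> = c gchoose p"
    by (simp add: res_coeff_def fls_shifted_times_simps)
  finally show ?thesis .
qed

lemma expm1_pow_coeff_conv:
  "expm1_pow_coeff k j = fps_nth ((fps_exp 1 - 1) ^ k) j"
proof -
  have "(fps_exp 1 - 1 :: complex fps) ^ k = (fps_exp 1 + (-1)) ^ k" by simp
  also have "\<dots> = (\<Sum>i\<le>k. of_nat (k choose i) * fps_exp 1 ^ i * (-1) ^ (k - i))"
    by (rule binomial_ring)
  also have "\<dots> = (\<Sum>i\<le>k. fps_const (of_nat (k choose i) * (-1) ^ (k - i)) * fps_exp (of_nat i))"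
    by (intro sum.cong)
       (simp_all add: fps_exp_power_mult fps_of_nat mult_ac flip: fps_const_mult fps_const_power fps_const_neg)
  finally show ?thesis
    by (simp add: fps_sum_nth expm1_pow_coeff_def sum_divide_distrib mult_ac)
qed

lemma fls_residue_X_intpow_exp:
  "fls_residue (fls_X_intpow i * fls_exp c) = (if i < 0 then c ^ nat (- i - 1) / fact (nat (- i - 1)) else 0)"
proof -
  have "- i - 1 = - 1 - i" by simp
  then show ?thesis by (simp only:) (simp add: fls_shifted_times_simps)
qed

lemma fls_nth_mult_eq_0:
  fixes H G :: "complex fls"
  assumes "\<And>j. j < N \<Longrightarrow> fls_nth H j = 0" "\<And>j. j < 0 \<Longrightarrow> fls_nth G j = 0" "j < N"
  shows "fls_nth (H * G) j = 0"
proof (cases "H = 0 \<or> G = 0")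
  case False
  have "fls_subdegree H \<ge> N" "fls_subdegree G \<ge> 0"
    using False assms(1,2) by (auto intro!: fls_subdegree_geI)
  with assms(3) show ?thesis
    by (intro fls_eq0_below_subdegree) (use False in auto)
qed auto

lemma fls_expm1_power: "(fls_exp 1 - 1) ^ k = fps_to_fls ((fps_exp 1 - 1 :: complex fps) ^ k)"
  by (simp add: fps_to_fls_power)

section \<open>The sign change in \<open>x\<close> that skew symmetry requires\<close>

definition fls_reflect :: "complex fls \<Rightarrow> complex fls" where
  "fls_reflect H = fls_compose_fps H (fps_const (-1) * fps_X)"

lemma fls_reflect_nth: "fls_nth (fls_reflect H) n = fls_nth H n * (-1) powi n"
  unfolding fls_reflect_def by (rule fls_nth_fls_compose_fps_linear) simp

lemma
  shows fls_reflect_mult: "fls_reflect (H * G) = fls_reflect H * fls_reflect G"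
    and fls_reflect_power: "fls_reflect (H ^ k) = fls_reflect H ^ k"
    and fls_reflect_diff: "fls_reflect (H - G) = fls_reflect H - fls_reflect G"
    and fls_reflect_add: "fls_reflect (H + G) = fls_reflect H + fls_reflect G"
    and fls_reflect_1: "fls_reflect 1 = 1"
    and fls_reflect_const: "fls_reflect (fls_const c) = fls_const c"
    and fls_reflect_exp: "fls_reflect (fls_exp c) = fls_exp (- c)"
proof -
  have *: "fps_const (-1) * fps_X \<noteq> (0 :: complex fps)" "fps_nth (fps_const (-1) * fps_X :: complex fps) 0 = 0"
    by simp_all
  show "fls_reflect (H * G) = fls_reflect H * fls_reflect G" "fls_reflect (H ^ k) = fls_reflect H ^ k"
       "fls_reflect (H - G) = fls_reflect H - fls_reflect G"
       "fls_reflect (H + G) = fls_reflect H + fls_reflect G"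
    unfolding fls_reflect_def using *
    by (simp_all only: fls_compose_fps_mult fls_compose_fps_power fls_compose_fps_diff fls_compose_fps_add
          not_False_eq_True)
  show "fls_reflect 1 = 1" "fls_reflect (fls_const c) = fls_const c" by (simp_all add: fls_reflect_def)
  have "fls_reflect (fls_exp c) = fps_to_fls (fps_exp c oo (fps_const (-1) * fps_X))"
    unfolding fls_reflect_def by (rule fls_compose_fps_to_fls[OF *])
  then show "fls_reflect (fls_exp c) = fls_exp (- c)"
    unfolding fps_exp_compose_linear by simp
qed

text \<open>From \<open>e^(-x) - 1 = -e^(-x) (e^x - 1)\<close>. The factor
  \<open>(e^x - 1)^k\<close> reappears, so associativity can be applied again after
  reflection.\<close>

lemma fls_reflect_expm1_power:
  "fls_reflect ((fls_exp 1 - 1) ^ k) = fls_const ((-1) ^ k) * fls_exp (- of_nat k) * (fls_exp 1 - 1) ^ k"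
proof -
  have "fls_exp (-1) * fls_exp 1 = 1"
    by (metis add.left_inverse fls_exp_add fps_exp_0 fps_one_to_fls)
  hence "fls_exp (-1) - 1 = - 1 * fls_exp (-1) * (fls_exp 1 - 1)"
    by (simp add: algebra_simps)
  hence "(fls_exp (-1) - 1) ^ k = (- 1) ^ k * fls_exp (-1) ^ k * (fls_exp 1 - 1) ^ k"
    by (simp only: power_mult_distrib)
  moreover have "fls_exp (-1) ^ k = fls_exp (- of_nat k)"
    by (simp add: fps_exp_power_mult flip: fps_to_fls_power)
  moreover have "(- 1 :: complex fls) ^ k = fls_const ((-1) ^ k)"
    by (simp add: fls_const_power)
  ultimately show ?thesis
    by (simp add: fls_reflect_power fls_reflect_diff fls_reflect_1 fls_reflect_exp)
qed

section \<open>Binomial identities\<close>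

lemma gbinomial_negative_choose:
  "(-1) ^ i * of_nat ((n + i) choose i) = (- (of_nat n + 1) :: 'a::field_char_0) gchoose i"
  unfolding gbinomial_minus by (simp add: binomial_gbinomial)

text \<open>Vandermonde: by symmetry the last factor is \<open>N + k + j\<close> over
  \<open>j - i\<close>, and the signed one is \<open>-(N + 1)\<close> over \<open>i\<close>. As
  \<open>j \<le> N\<close>, the range contains every nonzero term.\<close>

lemma bullet_binomial_sum:
  assumes "j \<le> N"
  shows "(\<Sum>i\<le>N. (-1) ^ i * of_nat ((N + i) choose i) * of_nat ((N + k + j) choose (N + i + k)))
    = (of_nat k + of_nat j - 1 :: 'a::field_char_0) gchoose j"
proof -
  have "(\<Sum>i\<le>N. (-1) ^ i * of_nat ((N + i) choose i) * of_nat ((N + k + j) choose (N + i + k)))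
    = (\<Sum>i\<le>j. (-1) ^ i * of_nat ((N + i) choose i) * (of_nat ((N + k + j) choose (N + i + k)) :: 'a))"
    by (rule sum.mono_neutral_right) (use assms in auto)
  also have "\<dots> = (\<Sum>i\<le>j. (- (of_nat N + 1) gchoose i) * (of_nat (N + k + j) gchoose (j - i)))"
  proof (rule sum.cong)
    fix i assume "i \<in> {..j}"
    hence "(N + k + j) choose (N + i + k) = (N + k + j) choose (j - i)"
      by (subst binomial_symmetric) auto
    then show "(-1) ^ i * of_nat ((N + i) choose i) * of_nat ((N + k + j) choose (N + i + k))
       = (- (of_nat N + 1 :: 'a) gchoose i) * (of_nat (N + k + j) gchoose (j - i))"
      by (simp only: gbinomial_negative_choose) (simp only: binomial_gbinomial)
  qed simp
  also have "\<dots> = (- (of_nat N + 1) + of_nat (N + k + j)) gchoose j"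
    unfolding atLeast0AtMost[symmetric] by (rule gbinomial_Vandermonde)
  finally show ?thesis by (simp add: algebra_simps)
qed

text \<open>The coefficient of \<open>z^s\<close> in
  \<open>(1 - z)^(-k) (1 - z)^k = 1\<close>.\<close>

lemma alternating_binomial_convolution:
  "(\<Sum>l\<le>s. (of_nat k + of_nat (s - l) - 1 gchoose (s - l)) * ((-1) ^ l * of_nat (k choose l)))
    = (if s = 0 then 1 else 0 :: 'a::field_char_0)"
proof -
  have "(\<Sum>l\<le>s. (of_nat k + of_nat (s - l) - 1 gchoose (s - l)) * ((-1) ^ l * of_nat (k choose l)))
    = (\<Sum>l\<le>s. (-1) ^ s * ((of_nat k gchoose l) * (- of_nat k gchoose (s - l) :: 'a)))"
  proof (rule sum.cong)
    fix l assume "l \<in> {..s}"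
    hence "s = l + (s - l)" by simp
    hence "(-1 :: 'a) ^ s = (-1) ^ l * (-1) ^ (s - l)" by (metis power_add)
    moreover have "(-1 :: 'a) ^ (s - l) * (-1) ^ (s - l) = 1"
      by (simp flip: power_mult_distrib)
    ultimately show "(of_nat k + of_nat (s - l) - 1 gchoose (s - l)) * ((-1) ^ l * of_nat (k choose l))
      = (-1) ^ s * ((of_nat k gchoose l) * (- of_nat k gchoose (s - l) :: 'a))"
      by (simp add: gbinomial_minus binomial_gbinomial)
  qed simp
  also have "\<dots> = (-1) ^ s * ((of_nat k + - of_nat k) gchoose s)"
    using gbinomial_Vandermonde[of "of_nat k :: 'a" "- of_nat k" s]
    by (simp add: atLeast0AtMost flip: sum_distrib_left)
  also have "\<dots> = (if s = 0 then 1 else 0)"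
    by (cases s) simp_all
  finally show ?thesis .
qed

section \<open>Vector-valued series\<close>

lemma supp_sum_eq_sum:
  assumes "finite A" "\<And>i. i \<notin> A \<Longrightarrow> f i = 0"
  shows "supp_sum f = sum f A"
  unfolding supp_sum_def by (rule sum.mono_neutral_left) (use assms in auto)

locale complex_vector_space = vector_space scale
  for scale :: "complex \<Rightarrow> 'w::ab_group_add \<Rightarrow> 'w" (infixr "\<odot>" 75)
begin

text \<open>\<open>vpair H f\<close> is the residue of \<open>H(x) \<Sum>\<^sub>n f(n) x\<^sup>-\<^sup>n\<^sup>-\<^sup>1\<close>.\<close>

definition vpair :: "complex fls \<Rightarrow> (int \<Rightarrow> 'w) \<Rightarrow> 'w" where
  "vpair H f = supp_sum (\<lambda>j. fls_nth H j \<odot> f j)"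

lemma vpair_eq_sum:
  assumes "\<And>j. j \<ge> M \<Longrightarrow> f j = 0" "\<And>j. j < L \<Longrightarrow> fls_nth H j = 0"
  shows "vpair H f = (\<Sum>j\<in>{L..<M}. fls_nth H j \<odot> f j)"
  unfolding vpair_def
proof (rule supp_sum_eq_sum)
  show "fls_nth H i \<odot> f i = 0" if "i \<notin> {L..<M}" for i
    using that assms(1)[of i] assms(2)[of i] by fastforce
qed simp

lemma vpair_eq_0:
  assumes "\<And>j. j \<ge> M \<Longrightarrow> f j = 0" "\<And>j. j < M \<Longrightarrow> fls_nth H j = 0"
  shows "vpair H f = 0"
  using vpair_eq_sum[of M f M H] assms by simp

text \<open>Truncation of \<open>f\<close> puts all three supports into one finite window; a sum
  over an infinite support would be 0 by default and additivity could fail.\<close>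

lemma vpair_add:
  assumes "\<And>j. j \<ge> M \<Longrightarrow> f j = 0"
  shows "vpair (H + G) f = vpair H f + vpair G f"
proof -
  define L where "L = min (fls_subdegree H) (fls_subdegree G)"
  have "vpair A f = (\<Sum>j\<in>{L..<M}. fls_nth A j \<odot> f j)" if "A \<in> {H, G, H + G}" for A
    by (rule vpair_eq_sum) (use that assms in \<open>auto simp: L_def\<close>)
  then show ?thesis
    by (simp add: scale_left_distrib sum.distrib)
qed

lemma vpair_scale: "vpair (fls_const c * H) f = c \<odot> vpair H f"
proof (cases "c = 0")
  case False
  have "supp_sum (\<lambda>j. c \<odot> (fls_nth H j \<odot> f j)) = c \<odot> supp_sum (\<lambda>j. fls_nth H j \<odot> f j)"
    unfolding supp_sum_def using False by (simp add: scale_sum_right)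
  then show ?thesis by (simp add: vpair_def)
qed (simp add: vpair_def supp_sum_def)

lemma vpair_X_intpow: "vpair (fls_X_intpow i) f = f i"
  unfolding vpair_def by (subst supp_sum_eq_sum[of "{i}"]) auto

section \<open>Multiplication by powers of \<open>x1 - x2\<close>\<close>

text \<open>The coefficients of \<open>(x1 - x2)^k P\<close>. Exponents are counted in units of
  \<open>1/T\<close>, so a factor \<open>x1\<close> or \<open>x2\<close> shifts an index by
  \<open>T\<close>.\<close>

definition qcoef :: "nat \<Rightarrow> (int \<Rightarrow> int \<Rightarrow> 'w) \<Rightarrow> nat \<Rightarrow> int \<Rightarrow> int \<Rightarrow> 'w" where
  "qcoef T P k a b = (\<Sum>j\<le>k. ((-1) ^ j * of_nat (k choose j)) \<odot>
      P (a - int T * int (k - j)) (b - int T * int j))"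

lemma qcoef_Suc: "qcoef T P (Suc k) a b = qcoef T P k (a - int T) b - qcoef T P k a (b - int T)"
proof -
  define p where "p j = P (a - int T * int (Suc k - j)) (b - int T * int j)" for j
  have 1: "qcoef T P k (a - int T) b = (\<Sum>j\<le>k. ((-1) ^ j * of_nat (k choose j)) \<odot> p j)"
    unfolding qcoef_def p_def
    by (intro sum.cong refl arg_cong2[where f = "(\<odot>)"] arg_cong2[where f = P])
       (auto simp: algebra_simps Suc_diff_le)
  have "qcoef T P k a (b - int T) = (\<Sum>j\<le>k. ((-1) ^ j * of_nat (k choose j)) \<odot> p (Suc j))"
    unfolding qcoef_def p_def
    by (intro sum.cong refl arg_cong2[where f = "(\<odot>)"] arg_cong2[where f = P])
       (auto simp: algebra_simps)
  hence 2: "- qcoef T P k a (b - int T) =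
      (\<Sum>j\<le>k. ((-1) ^ Suc j * of_nat (k choose j)) \<odot> p (Suc j))"
    by (simp add: sum_negf)
  have "qcoef T P (Suc k) a b = (\<Sum>j\<le>Suc k. ((-1) ^ j * of_nat (Suc k choose j)) \<odot> p j)"
    by (simp add: qcoef_def p_def)
  also have "\<dots> = p 0 + (\<Sum>j\<le>k. ((-1) ^ Suc j * of_nat (k choose Suc j)) \<odot> p (Suc j)
      + ((-1) ^ Suc j * of_nat (k choose j)) \<odot> p (Suc j))"
    by (subst sum.atMost_Suc_shift) (simp add: algebra_simps)
  also have "\<dots> = (\<Sum>j\<le>Suc k. ((-1) ^ j * of_nat (k choose j)) \<odot> p j) - qcoef T P k a (b - int T)"
    by (subst sum.atMost_Suc_shift) (simp only: sum.distrib 2[symmetric], simp)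
  also have "(\<Sum>j\<le>Suc k. ((-1) ^ j * of_nat (k choose j)) \<odot> p j) = qcoef T P k (a - int T) b"
    by (simp add: 1)
  finally show ?thesis .
qed

lemma qcoef_eq_0_right:
  assumes P: "\<And>a b. b < n \<Longrightarrow> P a b = 0" and "b < n"
  shows "qcoef T P k a b = 0"
proof -
  have "P a' (b - int T * int j) = 0" for a' j
  proof (rule P)
    have "0 \<le> int T * int j" by simp
    with \<open>b < n\<close> show "b - int T * int j < n" by linarith
  qed
  then show ?thesis by (simp add: qcoef_def)
qed

lemma qcoef_eq_0_not_dvd:
  assumes P: "\<And>a b. \<not> int T dvd a + r \<Longrightarrow> P a b = 0" and a: "\<not> int T dvd a + r"
  shows "qcoef T P k a b = 0"
proof -
  have "P (a - int T * m) b' = 0" for m b'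
  proof (rule P)
    have "a - int T * m + r = (a + r) - int T * m" by simp
    then show "\<not> int T dvd a - int T * m + r"
      using a by (metis diff_add_cancel dvd_add dvd_triv_left)
  qed
  then show ?thesis by (simp add: qcoef_def)
qed

text \<open>The \<open>\<phi>\<close>-coordinated associativity relation
  \<open>x\<^sub>2\<^sup>k (e\<^sup>x - 1)\<^sup>k F(x, x\<^sub>2) = ((x\<^sub>1 - x\<^sub>2)\<^sup>k P(x\<^sub>1, x\<^sub>2))|\<^bsub>x\<^sub>1 = x\<^sub>2 e\<^sup>x\<^esub>\<close>, paired with an arbitrary scalar
  Laurent series \<open>H\<close> in \<open>x\<close>; \<open>F d n\<close> is the coefficient of \<open>x\<^sup>-\<^sup>n\<^sup>-\<^sup>1 x\<^sub>2\<^bsup>d/T\<^esup>\<close>.\<close>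

definition phi_assoc :: "nat \<Rightarrow> nat \<Rightarrow> (int \<Rightarrow> int \<Rightarrow> 'w) \<Rightarrow> (int \<Rightarrow> int \<Rightarrow> 'w) \<Rightarrow> bool" where
  "phi_assoc T k P F \<longleftrightarrow>
     (\<exists>N. \<forall>a b. a < N \<or> b < N \<longrightarrow> qcoef T P k a b = 0) \<and>
     (\<forall>d. \<exists>M. \<forall>n\<ge>M. F d n = 0) \<and>
     (\<forall>d H. vpair (H * (fls_exp 1 - 1) ^ k) (F d) =
        supp_sum (\<lambda>a. fls_residue (H * fls_exp (of_int a / of_nat T))
          \<odot> qcoef T P k a (int T * int k + d - a)))"

section \<open>Associativity for all scalar series, and raising its exponent\<close>

lemma qcoef_diagonal_sum:
  assumes "\<And>a b. a < N \<or> b < N \<Longrightarrow> qcoef T P k a b = 0"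
  shows "supp_sum (\<lambda>a. r a \<odot> qcoef T P k a (c - a)) = (\<Sum>a\<in>{N..c - N}. r a \<odot> qcoef T P k a (c - a))"
  by (rule supp_sum_eq_sum) (use assms in auto)

text \<open>The hypothesis \<open>ax\<close> is the case \<open>H = x^(-m-1)\<close>; linearity in
  \<open>H\<close> and induction on the principal part give all Laurent series.\<close>

lemma phi_assocI:
  assumes N: "\<And>a b. a < N \<or> b < N \<Longrightarrow> qcoef T P k a b = 0"
    and M: "\<And>d. \<exists>M. \<forall>n\<ge>M. F d n = 0"
    and ax: "\<And>m c. supp_sum (\<lambda>n. (if m + n + 1 \<ge> 0 then expm1_pow_coeff k (nat (m + n + 1)) else 0)
              \<odot> F (c - int T * int k) n)
        = (if m < 0 then 0 else
            supp_sum (\<lambda>a. ((of_int a / of_nat T) ^ nat m / fact (nat m)) \<odot> qcoef T P k a (c - a)))"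
  shows "phi_assoc T k P F"
  unfolding phi_assoc_def
proof (intro conjI allI)
  show "\<exists>N. \<forall>a b. a < N \<or> b < N \<longrightarrow> qcoef T P k a b = 0"
    using N by blast
  show "\<exists>M. \<forall>n\<ge>M. F d n = 0" for d by (rule M)
  fix d H
  obtain M0 where M0: "\<And>n. n \<ge> M0 \<Longrightarrow> F d n = 0" using M by blast
  let ?R = "\<lambda>H. \<Sum>a\<in>{N..int T * int k + d - N}. fls_residue (H * fls_exp (of_int a / of_nat T))
          \<odot> qcoef T P k a (int T * int k + d - a)"
  have "vpair (H * (fls_exp 1 - 1) ^ k) (F d) = ?R H"
  \<comment> \<open>Order at least \<open>M0\<close> kills the pairing with \<open>F d\<close>,
    order at least 0 kills the residues.\<close>
  proof (induction H rule: fls_prpart_induct[where N = "max M0 0"])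
    case (1 H)
    have "vpair (H * (fls_exp 1 - 1) ^ k) (F d) = 0"
      unfolding fls_expm1_power
      by (rule vpair_eq_0[of M0])
         (use M0 in \<open>auto intro!: fls_nth_mult_eq_0[of "max M0 0"] simp: 1\<close>)
    moreover have "fls_residue (H * fls_exp c) = 0" for c
      using fls_nth_mult_eq_0[of "max M0 0" H "fls_exp c" "-1"] 1 by simp
    ultimately show ?case by simp
  next
    case (2 c i)
    define m where "m = - i - 1"
    have "vpair (fls_X_intpow i * (fls_exp 1 - 1) ^ k) (F d) =
      supp_sum (\<lambda>n. (if m + n + 1 \<ge> 0 then expm1_pow_coeff k (nat (m + n + 1)) else 0)
              \<odot> F ((int T * int k + d) - int T * int k) n)"
      unfolding vpair_def fls_expm1_power expm1_pow_coeff_conv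
      by (rule arg_cong[where f = supp_sum]) (auto simp: fls_shifted_times_simps m_def algebra_simps)
    also have "\<dots> = ?R (fls_X_intpow i)"
      unfolding ax fls_residue_X_intpow_exp
      by (subst qcoef_diagonal_sum[OF N]) (auto simp: m_def)
    finally show ?case
      unfolding mult.assoc vpair_scale fls_residue_fls_const_times
      by (simp add: scale_sum_right del: fls_residue_def)
  next
    case (3 H G)
    then show ?case
      using M0 by (simp add: distrib_right vpair_add[of M0] fls_residue_add scale_left_distrib sum.distrib)
  qed
  then show "vpair (H * (fls_exp 1 - 1) ^ k) (F d) =
        supp_sum (\<lambda>a. fls_residue (H * fls_exp (of_int a / of_nat T))
          \<odot> qcoef T P k a (int T * int k + d - a))"
    by (subst qcoef_diagonal_sum[OF N]) auto
qed

text \<open>Absorb a factor \<open>e^x - 1\<close> into \<open>H\<close>. On the right it takes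
  differences of residues at \<open>a + T\<close> and \<open>a\<close>; summation by parts moves
  these onto the coefficients as a factor \<open>x1 - x2\<close>.\<close>

lemma phi_assoc_Suc:
  assumes "phi_assoc T k P F" "T > 0"
  shows "phi_assoc T (Suc k) P F"
proof -
  obtain N where N: "\<And>a b. a < N \<or> b < N \<Longrightarrow> qcoef T P k a b = 0"
    using assms unfolding phi_assoc_def by blast
  have N': "qcoef T P (Suc k) a b = 0" if "a < N \<or> b < N" for a b
    using that N by (auto simp: qcoef_Suc)
  have M: "\<exists>M. \<forall>n\<ge>M. F d n = 0" for d
    using assms unfolding phi_assoc_def by blast
  have "vpair (H * (fls_exp 1 - 1) ^ Suc k) (F d) =
        supp_sum (\<lambda>a. fls_residue (H * fls_exp (of_int a / of_nat T))
          \<odot> qcoef T P (Suc k) a (int T * int (Suc k) + d - a))" for H d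
  proof -
    define r where "r a = fls_residue (H * fls_exp (of_int a / of_nat T))" for a :: int
    define c where "c = int T * int k + d"
    have rT: "fls_residue (H * (fls_exp 1 - 1) * fls_exp (of_int a / of_nat T)) = r (a + int T) - r a" for a
    proof -
      have "of_int (a + int T) / of_nat T = 1 + (of_int a / of_nat T :: complex)"
        using assms(2) by (simp add: field_simps)
      hence "fls_exp (of_int (a + int T) / of_nat T) = fls_exp 1 * fls_exp (of_int a / of_nat T)"
        by (simp only: fls_exp_add)
      hence "H * (fls_exp 1 - 1) * fls_exp (of_int a / of_nat T) =
         H * fls_exp (of_int (a + int T) / of_nat T) - H * fls_exp (of_int a / of_nat T)"
        by (simp add: algebra_simps)
      thus ?thesis by (simp add: r_def)
    qed
    \<comment> \<open>The support \<open>{N..c - N}\<close> is padded by \<open>T\<close>; after the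
      index shift both sums fit into one window, all added terms being zero.\<close>
    let ?I = "{N - int T..c - N + int T}"
    have "vpair (H * (fls_exp 1 - 1) ^ Suc k) (F d) =
        vpair ((H * (fls_exp 1 - 1)) * (fls_exp 1 - 1) ^ k) (F d)"
      by (simp add: mult_ac)
    also have "\<dots> = supp_sum (\<lambda>a. (r (a + int T) - r a) \<odot> qcoef T P k a (c - a))"
      using assms unfolding phi_assoc_def c_def by (simp add: rT del: fls_residue_def)
    also have "\<dots> = (\<Sum>a\<in>?I. (r (a + int T) - r a) \<odot> qcoef T P k a (c - a))"
      by (rule supp_sum_eq_sum) (use N in auto)
    also have "\<dots> = (\<Sum>a\<in>?I. r (a + int T) \<odot> qcoef T P k a (c - a))
        - (\<Sum>a\<in>?I. r a \<odot> qcoef T P k a (c - a))"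
      by (simp add: scale_left_diff_distrib sum_subtractf)
    also have "(\<Sum>a\<in>?I. r (a + int T) \<odot> qcoef T P k a (c - a)) =
       (\<Sum>a\<in>{N..c - N + 2 * int T}. r a \<odot> qcoef T P k (a - int T) (c + int T - a))"
      by (rule sum.reindex_bij_witness[of _ "\<lambda>a. a - int T" "\<lambda>a. a + int T"]) auto
    also have "\<dots> = (\<Sum>a\<in>{N - int T..c - N + 2 * int T}. r a \<odot> qcoef T P k (a - int T) (c + int T - a))"
      by (rule sum.mono_neutral_left) (use N in auto)
    also have "(\<Sum>a\<in>?I. r a \<odot> qcoef T P k a (c - a)) =
        (\<Sum>a\<in>{N - int T..c - N + 2 * int T}. r a \<odot> qcoef T P k a (c - a))"
      by (rule sum.mono_neutral_left) (use N in auto)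
    also have "(\<Sum>a\<in>{N - int T..c - N + 2 * int T}. r a \<odot> qcoef T P k (a - int T) (c + int T - a))
      - (\<Sum>a\<in>{N - int T..c - N + 2 * int T}. r a \<odot> qcoef T P k a (c - a))
      = (\<Sum>a\<in>{N - int T..c - N + 2 * int T}. r a \<odot> qcoef T P (Suc k) a (c + int T - a))"
      by (simp add: qcoef_Suc scale_right_diff_distrib sum_subtractf)
    also have "\<dots> = supp_sum (\<lambda>a. r a \<odot> qcoef T P (Suc k) a (c + int T - a))"
      by (rule supp_sum_eq_sum[symmetric]) (use N' in auto)
    finally show ?thesis
      by (simp add: r_def c_def algebra_simps del: fls_residue_def)
  qed
  with N' M show ?thesis
    unfolding phi_assoc_def by blast
qed

lemma phi_assoc_mono:
  assumes "phi_assoc T k P F" "T > 0" "k \<le> k'"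
  shows "phi_assoc T k' P F"
  using assms(3,1) by (induction rule: dec_induct) (auto intro: phi_assoc_Suc assms(2))

section \<open>Independence of exponentials and weak commutativity\<close>

text \<open>Lagrange interpolation: the powers may be replaced by any polynomial, in particular by
  one that vanishes at every node except \<open>f a\<close>.\<close>

lemma power_sums_eq_0_imp:
  fixes f :: "'a \<Rightarrow> complex"
  assumes A: "finite A" "inj_on f A" "\<And>m::nat. (\<Sum>a\<in>A. f a ^ m \<odot> q a) = 0" and a: "a \<in> A"
  shows "q a = 0"
proof -
  have *: "(\<Sum>a\<in>A. poly p (f a) \<odot> q a) = 0" for p
  proof -
    have "(\<Sum>a\<in>A. poly p (f a) \<odot> q a) =
        (\<Sum>a\<in>A. \<Sum>i\<le>degree p. coeff p i \<odot> f a ^ i \<odot> q a)"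
      by (simp add: poly_altdef scale_sum_left)
    also have "\<dots> = (\<Sum>i\<le>degree p. coeff p i \<odot> (\<Sum>a\<in>A. f a ^ i \<odot> q a))"
      by (subst sum.swap) (simp only: scale_sum_right)
    finally show ?thesis by (simp add: A(3))
  qed
  define p where "p = (\<Prod>b\<in>A - {a}. [:- f b, 1:])"
  have "poly p (f b) = 0" if "b \<in> A - {a}" for b
    using that A(1) by (auto simp: p_def poly_prod)
  hence "(\<Sum>b\<in>A. poly p (f b) \<odot> q b) = poly p (f a) \<odot> q a"
    using A(1) a by (subst sum.remove[of _ a]) auto
  moreover have "poly p (f a) \<noteq> 0"
    using A(1,2) a by (auto simp: p_def poly_prod inj_on_def)
  ultimately show ?thesis using * by simp
qed

text \<open>Pairing with \<open>H = x^(-m-1)\<close> extracts \<open>(a/T)^m / m!\<close>, so all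
  power sums at the distinct nodes \<open>a/T\<close> vanish.\<close>

lemma residue_pairings_eq_0_imp:
  fixes q :: "int \<Rightarrow> 'w"
  assumes "finite A" "\<And>a. a \<notin> A \<Longrightarrow> q a = 0" "T > 0"
    and "\<And>H. (\<Sum>a\<in>A. fls_residue (H * fls_exp (of_int a / of_nat T)) \<odot> q a) = 0"
  shows "q a = 0"
proof (cases "a \<in> A")
  case True
  have "(\<Sum>a\<in>A. (of_int a / of_nat T :: complex) ^ m \<odot> q a) = 0" for m
  proof -
    have "(\<Sum>a\<in>A. (of_int a / of_nat T :: complex) ^ m \<odot> q a) =
      fact m \<odot> (\<Sum>a\<in>A. fls_residue (fls_X_intpow (- int m - 1) * fls_exp (of_int a / of_nat T)) \<odot> q a)"
      unfolding fls_residue_X_intpow_exp by (simp add: scale_sum_right)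
    then show ?thesis by (simp add: assms(4) del: fls_residue_def)
  qed
  moreover have "inj_on (\<lambda>a. of_int a / of_nat T :: complex) A"
    using assms(3) by (auto simp: inj_on_def)
  ultimately show ?thesis
    using power_sums_eq_0_imp[of A "\<lambda>a. of_int a / of_nat T" q a] assms(1) True by blast
qed (use assms in auto)

text \<open>In generating series, \<open>skew\<close> reads \<open>F'(x) = e^(cx) F(-x)\<close>. The
  outer sign appears because replacing \<open>x\<close> by \<open>-x\<close> negates a
  residue.\<close>

lemma vpair_reflect_skew:
  assumes F: "\<And>n. n \<ge> M \<Longrightarrow> F n = 0" and F': "\<And>n. n \<ge> M' \<Longrightarrow> F' n = 0"
    and skew: "\<And>l. F' l = supp_sum (\<lambda>i::nat. ((-1) powi (l + int i + 1) * (c ^ i / fact i)) \<odot> F (l + int i))"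
  shows "vpair H F' = - vpair (fls_reflect (H * fls_exp c)) F"
proof (induction H rule: fls_prpart_induct[where N = "max M M'"])
  case (1 H)
  have "vpair H F' = 0"
    by (rule vpair_eq_0[of M']) (use F' 1 in auto)
  moreover have "vpair (fls_reflect (H * fls_exp c)) F = 0"
  proof (rule vpair_eq_0[of M])
    fix j assume "j < M"
    hence "fls_nth (H * fls_exp c) j = 0"
      by (intro fls_nth_mult_eq_0[of "max M M'"]) (use 1 in auto)
    thus "fls_nth (fls_reflect (H * fls_exp c)) j = 0" by (simp add: fls_reflect_nth)
  qed (use F in auto)
  ultimately show ?case by simp
next
  case (2 a l)
  let ?K = "fls_reflect (fls_X_intpow l * fls_exp c)"
  have K: "fls_nth ?K j = (if j \<ge> l then c ^ nat (j - l) / fact (nat (j - l)) * (-1) powi j else 0)" for j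
    by (simp add: fls_reflect_nth fls_shifted_times_simps)
  have "vpair ?K F = (\<Sum>j\<in>{l..<M}. fls_nth ?K j \<odot> F j)"
    by (rule vpair_eq_sum) (use F K in auto)
  also have "\<dots> = (\<Sum>i<nat (M - l). (c ^ i / fact i * (-1) powi (l + int i)) \<odot> F (l + int i))"
    by (rule sum.reindex_bij_witness[of _ "\<lambda>i. l + int i" "\<lambda>j. nat (j - l)"]) (auto simp: K)
  also have "\<dots> = - (\<Sum>i<nat (M - l). ((-1) powi (l + int i + 1) * (c ^ i / fact i)) \<odot> F (l + int i))"
    by (simp add: power_int_add sum_negf mult_ac)
  also have "(\<Sum>i<nat (M - l). ((-1) powi (l + int i + 1) * (c ^ i / fact i)) \<odot> F (l + int i)) = F' l"
    unfolding skew by (rule supp_sum_eq_sum[symmetric]) (use F in auto)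
  finally have "F' l = - vpair ?K F" by simp
  then show ?case
    by (simp add: vpair_scale vpair_X_intpow fls_reflect_mult fls_reflect_const mult.assoc)
next
  case (3 H G)
  then show ?case
    using F F' by (simp add: vpair_add[of M'] vpair_add[of M] distrib_right fls_reflect_add)
qed

text \<open>Weak commutativity. Skew symmetry relates the iterate sides of both associativity
  relations; independence of exponentials then compares the product sides along each diagonal
  \<open>a + b = c\<close>. Reflecting \<open>(e^x - 1)^k\<close> produces the sign.\<close>

lemma phi_assoc_skew:
  assumes "phi_assoc T k P F" "phi_assoc T k P' F'" "T > 0"
    and skew: "\<And>d l. F' d l = supp_sum (\<lambda>i::nat. ((-1) powi (l + int i + 1) * ((of_int d / of_nat T) ^ i / fact i))
        \<odot> F d (l + int i))"
  shows "qcoef T P' k a b = (-1) ^ k \<odot> qcoef T P k b a"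
proof -
  obtain N1 where N1: "\<And>a b. a < N1 \<or> b < N1 \<Longrightarrow> qcoef T P k a b = 0"
    using assms(1) unfolding phi_assoc_def by blast
  obtain N2 where N2: "\<And>a b. a < N2 \<or> b < N2 \<Longrightarrow> qcoef T P' k a b = 0"
    using assms(2) unfolding phi_assoc_def by blast
  define N where "N = min N1 N2"
  have N: "qcoef T P k a b = 0" "qcoef T P' k a b = 0" if "a < N \<or> b < N" for a b
    using that N1[of a b] N2[of a b] by (auto simp: N_def)
  define c where "c = a + b"
  define d where "d = c - int T * int k"
  have c: "int T * int k + d = c" by (simp add: d_def)
  obtain M where M: "\<And>n. n \<ge> M \<Longrightarrow> F d n = 0"
    using assms(1) unfolding phi_assoc_def by blast
  obtain M' where M': "\<And>n. n \<ge> M' \<Longrightarrow> F' d n = 0"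
    using assms(2) unfolding phi_assoc_def by blast
  define q where "q a = qcoef T P' k a (c - a) - (-1) ^ k \<odot> qcoef T P k (c - a) a" for a
  let ?I = "{N..c - N}"
  have "q a = 0"
  proof (rule residue_pairings_eq_0_imp[of ?I])
    show "q a = 0" if "a \<notin> ?I" for a
      using that N by (auto simp: q_def)
    fix H
    let ?r = "\<lambda>a. fls_residue (H * fls_exp (of_int a / of_nat T))"
    define H' where "H' = fls_reflect H * fls_exp (- of_nat k) * fls_exp (- of_int d / of_nat T)"
    \<comment> \<open>Since \<open>c/T = k + d/T\<close>, the exponentials in \<open>H'\<close> turn
      index \<open>a\<close> into \<open>c - a\<close>, which exchanges the two variables.\<close>
    have res: "fls_residue (H' * fls_exp (of_int a / of_nat T)) = - ?r (c - a)" for a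
    proof -
      have "of_int (c - a) / of_nat T = of_nat k + (of_int d / of_nat T - of_int a / of_nat T :: complex)"
        using assms(3) by (simp add: c[symmetric] field_simps)
      hence "fls_reflect (fls_exp (of_int (c - a) / of_nat T)) =
          fls_exp (- of_nat k + (- of_int d / of_nat T + of_int a / of_nat T))"
        by (simp add: fls_reflect_exp algebra_simps)
      hence "H' * fls_exp (of_int a / of_nat T) = fls_reflect (H * fls_exp (of_int (c - a) / of_nat T))"
        by (simp only: fls_exp_add H'_def fls_reflect_mult mult.assoc)
      then show ?thesis by (simp add: fls_reflect_nth)
    qed
    have "(\<Sum>a\<in>?I. ?r a \<odot> qcoef T P' k a (c - a)) =
        supp_sum (\<lambda>a. ?r a \<odot> qcoef T P' k a (c - a))"
      by (rule qcoef_diagonal_sum[symmetric]) (use N in auto)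
    also have "\<dots> = vpair (H * (fls_exp 1 - 1) ^ k) (F' d)"
      using assms(2) unfolding phi_assoc_def by (simp add: c)
    also have "\<dots> = - vpair (fls_reflect (H * (fls_exp 1 - 1) ^ k * fls_exp (of_int d / of_nat T))) (F d)"
      by (rule vpair_reflect_skew[of M _ M', OF M M' skew])
    also have "fls_reflect (H * (fls_exp 1 - 1) ^ k * fls_exp (of_int d / of_nat T)) =
       fls_const ((-1) ^ k) * (H' * (fls_exp 1 - 1) ^ k)"
      by (simp add: fls_reflect_mult fls_reflect_expm1_power H'_def fls_reflect_exp mult_ac)
    also have "vpair \<dots> (F d) = (-1) ^ k \<odot> vpair (H' * (fls_exp 1 - 1) ^ k) (F d)"
      by (rule vpair_scale)
    also have "vpair (H' * (fls_exp 1 - 1) ^ k) (F d) =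
        supp_sum (\<lambda>a. (- ?r (c - a)) \<odot> qcoef T P k a (c - a))"
      using assms(1) unfolding phi_assoc_def by (simp add: c res del: fls_residue_def)
    also have "\<dots> = (\<Sum>a\<in>?I. (- ?r (c - a)) \<odot> qcoef T P k a (c - a))"
      by (rule qcoef_diagonal_sum) (use N in auto)
    also have "\<dots> = (\<Sum>a\<in>?I. (- ?r a) \<odot> qcoef T P k (c - a) a)"
      by (rule sum.reindex_bij_witness[of _ "\<lambda>a. c - a" "\<lambda>a. c - a"]) auto
    finally have "(\<Sum>a\<in>?I. ?r a \<odot> qcoef T P' k a (c - a)) =
      (\<Sum>a\<in>?I. ?r a \<odot> (-1) ^ k \<odot> qcoef T P k (c - a) a)"
      by (simp add: scale_sum_right sum_negf mult_ac del: fls_residue_def)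
    then show "(\<Sum>a\<in>?I. ?r a \<odot> q a) = 0"
      by (simp add: q_def scale_right_diff_distrib sum_subtractf del: fls_residue_def)
  qed (use assms in auto)
  then show ?thesis by (simp add: q_def c_def)
qed

section \<open>Uniqueness of the iterate and the creation property\<close>

text \<open>\<open>(e^x - 1)^k\<close> is invertible among Laurent series, so a suitable
  \<open>H\<close> isolates each coefficient of the iterate.\<close>

lemma phi_assoc_unique:
  assumes "phi_assoc T k P F" "phi_assoc T k P G"
  shows "F = G"
proof (intro ext)
  fix d n
  define H where "H = fls_X_intpow n * inverse ((fls_exp 1 - 1) ^ k)"
  have "H * (fls_exp 1 - 1) ^ k = fls_X_intpow n"
    by (simp add: H_def mult.assoc)
  moreover have "vpair (H * (fls_exp 1 - 1) ^ k) (F d) = vpair (H * (fls_exp 1 - 1) ^ k) (G d)"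
    using assms unfolding phi_assoc_def by (simp del: fls_residue_def)
  ultimately show "F d n = G d n" by (simp add: vpair_X_intpow)
qed

text \<open>\<open>P\<close> involves \<open>x1\<close> alone, so substituting
  \<open>x1 = x2 e^x\<close> is possible already for \<open>k = 0\<close> and gives the candidate
  \<open>G\<close>. Raising the exponent to \<open>k\<close> and uniqueness identify
  \<open>G\<close> with \<open>F\<close>.\<close>

lemma phi_assoc_creation:
  assumes "phi_assoc T k P F" "T > 0"
    and P: "\<And>a b. P a b = (if b = 0 then z a else 0)" and z: "\<And>a. a < N \<Longrightarrow> z a = 0"
  shows "F d (- 1 - int i) = ((of_int d / of_nat T) ^ i / fact i) \<odot> z d"
proof -
  define G where "G d n = (if n < 0 then ((of_int d / of_nat T) ^ nat (- n - 1) / fact (nat (- n - 1))) \<odot> z d else 0)"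
    for d n :: int
  have "phi_assoc T 0 P G"
  proof (rule phi_assocI[where N = "min N 0"])
    have q: "qcoef T P 0 a b = P a b" for a b by (simp add: qcoef_def)
    show "qcoef T P 0 a b = 0" if "a < min N 0 \<or> b < min N 0" for a b
      using that z by (auto simp: q P)
    show "\<exists>M. \<forall>n\<ge>M. G d n = 0" for d
      by (rule exI[of _ 0]) (auto simp: G_def)
    fix m c :: int
    have "supp_sum (\<lambda>n. (if m + n + 1 \<ge> 0 then expm1_pow_coeff 0 (nat (m + n + 1)) else 0)
              \<odot> G (c - int T * int 0) n) = G c (- m - 1)"
      by (subst supp_sum_eq_sum[of "{- m - 1}"]) (auto simp: expm1_pow_coeff_conv)
    also have "\<dots> = (if m < 0 then 0 else ((of_int c / of_nat T) ^ nat m / fact (nat m)) \<odot> z c)"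
      by (auto simp: G_def)
    also have "((of_int c / of_nat T) ^ nat m / fact (nat m)) \<odot> z c =
      supp_sum (\<lambda>a. ((of_int a / of_nat T) ^ nat m / fact (nat m)) \<odot> qcoef T P 0 a (c - a))"
      by (subst supp_sum_eq_sum[of "{c}"]) (auto simp: q P)
    finally show "supp_sum (\<lambda>n. (if m + n + 1 \<ge> 0 then expm1_pow_coeff 0 (nat (m + n + 1)) else 0)
              \<odot> G (c - int T * int 0) n) = (if m < 0 then 0 else
      supp_sum (\<lambda>a. ((of_int a / of_nat T) ^ nat m / fact (nat m)) \<odot> qcoef T P 0 a (c - a)))" .
  qed
  hence "phi_assoc T k P G" using phi_assoc_mono assms(2) by blast
  hence "F = G" using phi_assoc_unique assms(1) by blast
  then show ?thesis by (simp add: G_def)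
qed

section \<open>Residues as binomial sums, and vanishing in low total degree\<close>

text \<open>\<open>H\<close> carries \<open>k\<close> extra negative powers of
  \<open>e^x - 1\<close>, which the factor in the relation cancels; its residues against
  exponentials are the binomial coefficients.\<close>

lemma phi_assoc_residue:
  assumes "phi_assoc T k P F"
  shows "vpair (fls_exp (\<alpha> + 1) * (fls_exp 1 - 1) powi (- (int p + 1))) (F d) =
    supp_sum (\<lambda>a. ((\<alpha> + of_int a / of_nat T) gchoose (p + k)) \<odot> qcoef T P k a (int T * int k + d - a))"
proof -
  let ?E = "fls_exp 1 - 1"
  define H where "H = fls_exp (\<alpha> + 1) * ?E powi (- (int (p + k) + 1))"
  have "?E powi (- (int (p + k) + 1)) * ?E ^ k = ?E powi (- (int (p + k) + 1)) * ?E powi int k"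
    by simp
  also have "\<dots> = ?E powi (- (int p + 1))"
    by (subst power_int_add[symmetric]) auto
  finally have "fls_exp (\<alpha> + 1) * ?E powi (- (int p + 1)) = H * ?E ^ k"
    by (simp add: H_def mult.assoc)
  moreover have "fls_residue (H * fls_exp c) = (\<alpha> + c) gchoose (p + k)" for c
  proof -
    have "H * fls_exp c = fls_exp ((\<alpha> + c) + 1) * ?E powi (- (int (p + k) + 1))"
      by (simp only: H_def fls_exp_add mult_ac)
    then show ?thesis by (simp only: fls_residue_exp_div_power)
  qed
  ultimately show ?thesis
    using assms unfolding phi_assoc_def by (simp del: fls_residue_def)
qed

text \<open>In low total degree the iterate vanishes, hence so does \<open>(x1 - x2)^k P\<close>. To
  recover \<open>P\<close>, descend in \<open>b\<close>: in \<open>qcoef\<close> at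
  \<open>(a + T k, b)\<close> the term \<open>j = 0\<close> is \<open>P a b\<close>, and the others
  have the same total degree and smaller second index.\<close>

lemma phi_assoc_eq_0_below:
  assumes "phi_assoc T k P F" "T > 0"
    and F: "\<And>d j. d < n \<Longrightarrow> F d j = 0" and P: "\<And>a b. b < n \<Longrightarrow> P a b = 0"
  shows "a + b < n \<Longrightarrow> P a b = 0"
proof -
  obtain N where N: "\<And>a b. a < N \<or> b < N \<Longrightarrow> qcoef T P k a b = 0"
    using assms unfolding phi_assoc_def by blast
  have Q: "qcoef T P k a b = 0" if "a + b < n + int T * int k" for a b
  proof -
    define c where "c = a + b"
    define d where "d = c - int T * int k"
    have c: "int T * int k + d = c" by (simp add: d_def)
    have d: "d < n" using that by (simp add: d_def c_def)
    have "qcoef T P k a (c - a) = 0"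
    proof (rule residue_pairings_eq_0_imp[where q = "\<lambda>a. qcoef T P k a (c - a)" and A = "{N..c - N}"])
      fix H
      have "supp_sum (\<lambda>a. fls_residue (H * fls_exp (of_int a / of_nat T)) \<odot> qcoef T P k a (c - a)) =
        vpair (H * (fls_exp 1 - 1) ^ k) (F d)"
        using assms(1) unfolding phi_assoc_def by (simp add: c del: fls_residue_def)
      also have "\<dots> = 0" using F[OF d] by (simp add: vpair_def supp_sum_def)
      finally show "(\<Sum>a\<in>{N..c - N}. fls_residue (H * fls_exp (of_int a / of_nat T)) \<odot> qcoef T P k a (c - a)) = 0"
        using qcoef_diagonal_sum[OF N] by (simp del: fls_residue_def)
    qed (use N assms(2) in auto)
    then show ?thesis by (simp add: c_def)
  qed
  show "a + b < n \<Longrightarrow> P a b = 0"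
  proof (induction "nat (b - n + 1)" arbitrary: a b rule: less_induct)
    case less
    show ?case
    proof (cases "b < n")
      case False
      have "qcoef T P k (a + int T * int k) b =
        (\<Sum>j\<in>{..k}. if j = 0 then P a b else 0)"
        unfolding qcoef_def
      proof (rule sum.cong)
        fix j assume "j \<in> {..k}"
        have "P (a + int T * int k - int T * int (k - j)) (b - int T * int j) = 0" if "j > 0"
        proof (rule less.hyps)
          have "int T * int j > 0" using that assms(2) by simp
          then show "nat (b - int T * int j - n + 1) < nat (b - n + 1)" using False by simp
          show "a + int T * int k - int T * int (k - j) + (b - int T * int j) < n"
            using less.prems \<open>j \<in> {..k}\<close> by (simp add: of_nat_diff algebra_simps)
        qed
        then show "((-1) ^ j * of_nat (k choose j)) \<odot>
            P (a + int T * int k - int T * int (k - j)) (b - int T * int j) = (if j = 0 then P a b else 0)"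
          by auto
      qed simp
      hence "qcoef T P k (a + int T * int k) b = P a b" by simp
      then show ?thesis using Q[of "a + int T * int k" b] less.prems by simp
    qed (use P in auto)
  qed
qed

text \<open>Reads off the coefficient of \<open>x\<^sub>1\<^sup>0 x\<^sub>2\<^sup>0\<close> in \<open>P = (x\<^sub>1 - x\<^sub>2)\<^sup>-\<^sup>k (x\<^sub>1 - x\<^sub>2)\<^sup>k P\<close>, with \<open>(x\<^sub>1 - x\<^sub>2)\<^sup>-\<^sup>k\<close>
  expanded in nonnegative powers of \<open>x\<^sub>2\<close>.\<close>

lemma coeff_0_0_eq_qcoef_sum:
  assumes P: "\<And>s. s > N \<Longrightarrow> P (int T * int s) (- (int T * int s)) = 0"
  shows "(\<Sum>j\<le>N. (of_nat k + of_nat j - 1 gchoose j) \<odot> qcoef T P k (int T * int (k + j)) (- (int T * int j)))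
    = P 0 0"
proof -
  define p where "p s = P (int T * int s) (- (int T * int s))" for s
  have p0: "p s = 0" if "s > N" for s
    unfolding p_def by (rule P[OF that])
  let ?f = "\<lambda>l j. ((of_nat k + of_nat j - 1 gchoose j) * ((-1) ^ l * of_nat (k choose l))) \<odot> p (l + j)"
  have q: "qcoef T P k (int T * int (k + j)) (- (int T * int j)) =
     (\<Sum>l\<le>k. ((-1) ^ l * of_nat (k choose l)) \<odot> p (l + j))" for j
    unfolding qcoef_def p_def
    by (intro sum.cong refl arg_cong2[where f = "(\<odot>)"] arg_cong2[where f = P])
       (auto simp: algebra_simps of_nat_diff)
  have "(\<Sum>j\<le>N. (of_nat k + of_nat j - 1 gchoose j) \<odot> qcoef T P k (int T * int (k + j)) (- (int T * int j)))
    = (\<Sum>j\<le>N. \<Sum>l\<le>k. ?f l j)"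
    unfolding q by (simp add: scale_sum_right)
  also have "\<dots> = (\<Sum>(l, j)\<in>{..k} \<times> {..N}. ?f l j)"
    by (subst sum.swap) (simp add: sum.cartesian_product)
  \<comment> \<open>From rectangle to triangle: terms with \<open>l + j > N\<close> vanish by
    \<open>p0\<close>, those with \<open>l > k\<close> by the binomial factor.\<close>
  also have "\<dots> = (\<Sum>(l, j)\<in>{(l, j). l + j \<le> N}. ?f l j)"
  proof (rule sum.mono_neutral_cong)
    show "finite {(l, j). l + j \<le> N}"
      by (rule finite_subset[of _ "{..N} \<times> {..N}"]) auto
  qed (use p0 in \<open>auto simp: not_le binomial_eq_0\<close>)
  also have "\<dots> = (\<Sum>s\<le>N. \<Sum>l\<le>s. ?f l (s - l))"
    by (rule sum.triangle_reindex_eq)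
  also have "\<dots> = (\<Sum>s\<le>N. (if s = 0 then 1 else 0) \<odot> p s)"
    unfolding alternating_binomial_convolution[of k, symmetric] scale_sum_left
    by (intro sum.cong refl) auto
  also have "\<dots> = p 0"
    by (subst sum.mono_neutral_right[of _ "{0}"]) auto
  finally show ?thesis by (simp add: p_def)
qed

section \<open>Evaluation of the two residue products\<close>

text \<open>The case \<open>r = 0\<close>, where the exponent is \<open>n div T\<close>. Only
  \<open>a = T (k + j)\<close> with \<open>j \<le> N\<close> contributes;
  \<open>bullet_binomial_sum\<close> collapses the sum over \<open>i\<close> to the coefficients of
  \<open>(x1 - x2)^(-k)\<close>.\<close>

lemma bullet_residue_sum:
  assumes assoc: "phi_assoc T k P F" and T: "T > 0"
    and b: "\<And>a b. b < - int n \<Longrightarrow> P a b = 0"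
    and a: "\<And>a b. a < - int n \<Longrightarrow> qcoef T P k a b = 0"
    and dvd: "\<And>a b. \<not> int T dvd a \<Longrightarrow> P a b = 0"
  shows "(\<Sum>i\<le>n div T. ((-1) ^ i * of_nat ((n div T + i) choose i)) \<odot>
      vpair (fls_exp (of_nat (n div T) + 1) * (fls_exp 1 - 1) powi (- (int (n div T) + int i + 1))) (F 0)) = P 0 0"
proof -
  define N where "N = n div T"
  have below: "int T * t < - int n" if "t < - int N" for t
  proof -
    have "n < T * (N + 1)"
      using T by (simp add: N_def dividend_less_times_div)
    hence "int n < int T * (int N + 1)"
      by (metis of_nat_1 of_nat_add of_nat_less_iff of_nat_mult)
    also have "\<dots> \<le> int T * (- t)" using that by (intro mult_left_mono) auto
    finally show ?thesis by simp
  qed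
  have qdvd: "int T dvd a" if "qcoef T P k a b \<noteq> 0" for a b
    using that qcoef_eq_0_not_dvd[of T 0 P a k b] dvd by auto
  have qb: "qcoef T P k a b = 0" if "b < - int n" for a b
    using b that by (rule qcoef_eq_0_right)
  let ?q = "\<lambda>j. qcoef T P k (int T * int (k + j)) (- (int T * int j))"
  have "vpair (fls_exp (of_nat N + 1) * (fls_exp 1 - 1) powi (- (int N + int i + 1))) (F 0) =
     (\<Sum>j\<le>N. of_nat ((N + k + j) choose (N + i + k)) \<odot> ?q j)" for i
  proof -
    have "vpair (fls_exp (of_nat N + 1) * (fls_exp 1 - 1) powi (- (int (N + i) + 1))) (F 0) =
      supp_sum (\<lambda>a. ((of_nat N + of_int a / of_nat T) gchoose (N + i + k)) \<odot> qcoef T P k a (int T * int k - a))"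
      by (subst phi_assoc_residue[OF assoc]) simp
    also have "\<dots> = (\<Sum>a\<in>(\<lambda>j. int T * int (k + j)) ` {..N}.
        ((of_nat N + of_int a / of_nat T) gchoose (N + i + k)) \<odot> qcoef T P k a (int T * int k - a))"
    proof (rule supp_sum_eq_sum)
      fix a' assume nin: "a' \<notin> (\<lambda>j. int T * int (k + j)) ` {..N}"
      show "((of_nat N + of_int a' / of_nat T) gchoose (N + i + k)) \<odot> qcoef T P k a' (int T * int k - a') = 0"
      proof (cases "qcoef T P k a' (int T * int k - a') = 0")
        case False
        then obtain t where t: "a' = int T * t" using qdvd by blast
        have "int T * t \<ge> - int n"
          using False a[of a' "int T * int k - a'"] by (force simp: t)
        hence t1: "t \<ge> - int N" using below[of t] by linarith
        have "int T * (int k - t) \<ge> - int n"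
          using False qb[of "int T * int k - a'" a'] by (force simp: t algebra_simps)
        hence t2: "int k - t \<ge> - int N" using below[of "int k - t"] by linarith
        have "t < int k"
        proof (rule ccontr)
          assume "\<not> t < int k"
          then have "t = int (k + nat (t - int k))" "nat (t - int k) \<le> N" using t2 by auto
          hence "int T * t \<in> (\<lambda>j. int T * int (k + j)) ` {..N}" by (intro image_eqI) auto
          with nin show False by (simp add: t)
        qed
        \<comment> \<open>For \<open>t < k\<close> the upper entry is the natural number
          \<open>N + t\<close>, smaller than the lower entry \<open>N + i + k\<close>.\<close>
        define m where "m = nat (int N + t)"
        have "int m = int N + t" using t1 by (simp add: m_def)
        hence "of_nat N + of_int a' / of_nat T = (of_nat m :: complex)"
          using T by (simp add: t) (metis of_int_add of_int_of_nat_eq)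
        moreover have "m < N + i + k" using t1 \<open>t < int k\<close> by (simp add: m_def)
        ultimately show ?thesis by (simp add: binomial_eq_0 flip: binomial_gbinomial)
      qed simp
    qed simp
    also have "\<dots> = (\<Sum>j\<le>N. of_nat ((N + k + j) choose (N + i + k)) \<odot> ?q j)"
    proof (subst sum.reindex)
      show "inj_on (\<lambda>j. int T * int (k + j)) {..N}" using T by (auto simp: inj_on_def)
      have "of_nat N + of_int (int T * int (k + j)) / of_nat T = (of_nat (N + k + j) :: complex)" for j
        using T by (simp add: field_simps)
      then show "sum ((\<lambda>a. ((of_nat N + of_int a / of_nat T) gchoose (N + i + k)) \<odot>
          qcoef T P k a (int T * int k - a)) \<circ> (\<lambda>j. int T * int (k + j))) {..N} =
         (\<Sum>j\<le>N. of_nat ((N + k + j) choose (N + i + k)) \<odot> ?q j)"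
        unfolding binomial_gbinomial o_def
        by (intro sum.cong) (auto simp: algebra_simps)
    qed
    finally show ?thesis by simp
  qed
  hence "(\<Sum>i\<le>N. ((-1) ^ i * of_nat ((N + i) choose i)) \<odot>
      vpair (fls_exp (of_nat N + 1) * (fls_exp 1 - 1) powi (- (int N + int i + 1))) (F 0)) =
      (\<Sum>i\<le>N. \<Sum>j\<le>N. ((-1) ^ i * of_nat ((N + i) choose i) * of_nat ((N + k + j) choose (N + i + k))) \<odot> ?q j)"
    by (simp add: scale_sum_right)
  also have "\<dots> = (\<Sum>j\<le>N. (of_nat k + of_nat j - 1 gchoose j) \<odot> ?q j)"
    by (subst sum.swap)
       (intro sum.cong refl, simp add: bullet_binomial_sum[symmetric] scale_sum_left)
  also have "\<dots> = P 0 0"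
  proof (rule coeff_0_0_eq_qcoef_sum)
    fix s assume "s > N"
    then show "P (int T * int s) (- (int T * int s)) = 0"
      using b below[of "- int s"] by simp
  qed
  finally show ?thesis by (simp add: N_def)
qed

text \<open>Only \<open>a = T t - r\<close> with both exponents at least \<open>-n\<close> can
  contribute. There the upper entry is a natural number below the lower entry
  \<open>p - 1 + k\<close>, so each binomial coefficient is 0.\<close>

lemma diamond_residue_eq_0:
  assumes assoc: "phi_assoc T k P F" and T: "T > 0" and r: "r < T"
    and b: "\<And>a b. b < - int n \<Longrightarrow> P a b = 0"
    and a: "\<And>a b. a < - int n \<Longrightarrow> qcoef T P k a b = 0"
    and dvd: "\<And>a b. \<not> int T dvd a + int r \<Longrightarrow> P a b = 0"
    and \<alpha>: "\<alpha> = -1 + of_int (deltaT T (n mod T) r) + of_nat (n div T) + of_nat r / of_nat T"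
    and p: "p = 2 * int (n div T) + deltaT T (n mod T) r + deltaT T (n mod T) (T - r) + 1"
  shows "vpair (fls_exp (\<alpha> + 1) * (fls_exp 1 - 1) powi (- p)) (F 0) = 0"
proof -
  define N where "N = n div T"
  define s where "s = n mod T"
  have n: "int n = int T * int N + int s"
    unfolding N_def s_def by (metis mult_div_mod_eq of_nat_add of_nat_mult)
  have s: "s < T" using T by (simp add: s_def)
  define p' where "p' = nat (p - 1)"
  have p': "p = int p' + 1"
    by (simp add: p'_def p deltaT_def)
  have qdvd: "int T dvd a + int r" if "qcoef T P k a b \<noteq> 0" for a b
    using that qcoef_eq_0_not_dvd[of T "int r" P a k b] dvd by blast
  have qb: "qcoef T P k a b = 0" if "b < - int n" for a b
    using b that by (rule qcoef_eq_0_right)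
  have zero: "((\<alpha> + of_int a' / of_nat T) gchoose (p' + k)) \<odot> qcoef T P k a' (int T * int k - a') = 0" for a'
  proof (cases "qcoef T P k a' (int T * int k - a') = 0")
    case False
    then obtain t where "a' + int r = int T * t" using qdvd by blast
    hence t: "a' = int T * t - int r" by simp
    have lower: "int T * (t + int N) \<ge> int r - int s"
      using False a[of a' "int T * int k - a'"] by (force simp: t n algebra_simps)
    have upper: "int T * (t - int k - int N) \<le> int r + int s"
      using False qb[of "int T * int k - a'" a'] by (force simp: t n algebra_simps)
    have le: "x \<le> y" if "int T * x < int T * (y + 1)" for x y
      using that T by (simp add: mult_less_cancel_left)
    define m where "m = nat (- 1 + deltaT T s r + int N + t)"
    \<comment> \<open>From \<open>a \<ge> -n\<close>: \<open>t = -N\<close> is possible only if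
      \<open>r \<le> s\<close>, and then the delta is 1.\<close>
    have m1: "- 1 + deltaT T s r + int N + t \<ge> 0"
    proof (cases "r \<le> s")
      case True
      have "0 \<le> t + int N" by (rule le) (use lower s in \<open>simp add: algebra_simps\<close>)
      then show ?thesis using True r by (simp add: deltaT_def)
    next
      case False
      have "1 \<le> t + int N" by (rule le) (use lower False in \<open>simp add: algebra_simps\<close>)
      then show ?thesis using False r by (simp add: deltaT_def)
    qed
    \<comment> \<open>From \<open>b \<ge> -n\<close>: \<open>t\<close> is at most
      \<open>k + N\<close>, or \<open>k + N + 1\<close> when the delta at \<open>T - r\<close> is 1;
      that delta raises \<open>p\<close> by the same amount.\<close>
    have m2: "- 1 + deltaT T s r + int N + t < p - 1 + int k"
    proof (cases "r = 0 \<or> s < T - r")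
      case True
      have "t - int k - int N \<le> 0" by (rule le) (use upper True s r in \<open>auto simp: algebra_simps\<close>)
      then show ?thesis using True s by (auto simp: p deltaT_def N_def s_def)
    next
      case False
      have "t - int k - int N \<le> 1" by (rule le) (use upper s r in \<open>auto simp: algebra_simps\<close>)
      then show ?thesis using False r by (auto simp: p deltaT_def N_def s_def)
    qed
    have "of_int a' / of_nat T = of_int t - (of_nat r / of_nat T :: complex)"
      using T by (simp add: t field_simps)
    hence "\<alpha> + of_int a' / of_nat T = of_int (- 1 + deltaT T s r + int N + t)"
      by (simp add: \<alpha> N_def s_def)
    also have "\<dots> = of_nat m" using m1 by (simp add: m_def)
    finally have "\<alpha> + of_int a' / of_nat T = of_nat m" .
    moreover have "m < p' + k" using m1 m2 p' by (simp add: m_def)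
    ultimately show ?thesis by (simp add: binomial_eq_0 flip: binomial_gbinomial)
  qed simp
  have "vpair (fls_exp (\<alpha> + 1) * (fls_exp 1 - 1) powi (- (int p' + 1))) (F 0) =
    supp_sum (\<lambda>a. ((\<alpha> + of_int a / of_nat T) gchoose (p' + k)) \<odot> qcoef T P k a (int T * int k - a))"
    by (subst phi_assoc_residue[OF assoc]) simp
  also have "\<dots> = 0" by (simp only: zero) (simp add: supp_sum_def)
  finally show ?thesis by (simp only: p')
qed

end

section \<open>Vertex algebras and twisted modules\<close>

text \<open>The Jacobi identity at \<open>m = -1\<close>, \<open>n = 0\<close> applied to the
  vacuum: by the creation property only \<open>i = 0\<close> survives on the right.
  \<open>Y z (-1 - i) vac\<close> plays the part of \<open>D^i z / i!\<close>.\<close>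

lemma vertex_algebra_skew_symmetry:
  assumes "vertex_algebra sc Y vac"
  shows "Y v l u = supp_sum (\<lambda>i::nat. sc ((-1) powi (l + int i + 1)) (Y (Y u (l + int i) v) (- 1 - int i) vac))"
proof -
  interpret V: complex_vector_space sc
    using assms by (simp add: vertex_algebra_def complex_vector_space_def)
  have lin: "Vector_Spaces.linear sc sc (Y a n)" for a n
    using assms by (simp add: vertex_algebra_def)
  have lin': "Vector_Spaces.linear sc sc (\<lambda>a. Y a n b)" for n b
    using assms by (simp add: vertex_algebra_def)
  have Y0: "Y a n 0 = 0" for a n
    using module_hom.zero[OF lin[unfolded linear_iff_module_hom]] .
  have Y0': "Y 0 n b = 0" for n b
    using module_hom.zero[OF lin'[unfolded linear_iff_module_hom]] .
  have vac0: "Y a (int i) vac = 0" for a i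
    using assms by (simp add: vertex_algebra_def)
  have vac1: "Y a (- 1) vac = a" for a
    using assms by (simp add: vertex_algebra_def)
  have vac2: "Y a (int i - 1) vac = 0" if "i > 0" for a i
    using assms that by (simp add: vertex_algebra_def)
  have "\<exists>M. \<forall>n\<ge>M. Y u n v = 0"
    using assms unfolding vertex_algebra_def by (elim conjE) blast
  then obtain M where M: "\<And>n. n \<ge> M \<Longrightarrow> Y u n v = 0" by blast
  let ?c = "\<lambda>i. Y (Y u (l + int i) v) (- 1 - int i) vac"
  have borcherds: "supp_sum (\<lambda>i::nat. sc ((of_int (- 1) :: complex) gchoose i)
           (Y (Y u (l + int i) v) (- 1 + 0 - int i) vac))
      = supp_sum (\<lambda>i::nat. sc ((-1) ^ i * ((of_int l :: complex) gchoose i))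
            (Y u (l + - 1 - int i) (Y v (0 + int i) vac)
             - sc ((-1::complex) powi l) (Y v (l + 0 - int i) (Y u (- 1 + int i) vac))))"
    using assms unfolding vertex_algebra_def by blast
  have "(\<Sum>i<nat (M - l). sc ((-1) ^ i) (?c i)) = supp_sum (\<lambda>i. sc ((-1) ^ i) (?c i))"
    by (rule supp_sum_eq_sum[symmetric]) (use M in \<open>auto simp: Y0'\<close>)
  also have "\<dots> = supp_sum (\<lambda>i::nat. sc ((of_int (- 1) :: complex) gchoose i) (Y (Y u (l + int i) v) (- 1 + 0 - int i) vac))"
    using gbinomial_minus[of "1 :: complex"]
    by (simp flip: binomial_gbinomial)
  also have "\<dots> = - sc ((-1) powi l) (Y v l u)"
    unfolding borcherds by (subst supp_sum_eq_sum[of "{0}"]) (auto simp: vac0 vac0[of _ 0, simplified] vac1 vac2 Y0)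
  finally have "Y v l u = - sc ((-1) powi l) (\<Sum>i<nat (M - l). sc ((-1) ^ i) (?c i))"
    by simp
  also have "\<dots> = (\<Sum>i<nat (M - l). sc ((-1) powi (l + int i + 1)) (?c i))"
    by (simp add: V.scale_sum_right power_int_add sum_negf)
  also have "\<dots> = supp_sum (\<lambda>i. sc ((-1) powi (l + int i + 1)) (?c i))"
    by (rule supp_sum_eq_sum[symmetric]) (use M in \<open>auto simp: Y0'\<close>)
  finally show ?thesis .
qed

locale twisted_module = W: complex_vector_space scW
  for sc :: "complex \<Rightarrow> 'v::ab_group_add \<Rightarrow> 'v"
    and Y :: "'v \<Rightarrow> int \<Rightarrow> 'v \<Rightarrow> 'v" and vac :: 'v and g :: "'v \<Rightarrow> 'v" and T :: nat
    and scW :: "complex \<Rightarrow> 'w::ab_group_add \<Rightarrow> 'w" and YW :: "'v \<Rightarrow> int \<Rightarrow> 'w \<Rightarrow> 'w" +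
  assumes va: "vertex_algebra sc Y vac"
    and T: "T > 0"
    and tw: "twisted_phi_module sc Y vac g T scW YW"
begin

section \<open>Coefficient families of a twisted module\<close>

text \<open>Exponent \<open>a/T\<close> belongs to mode index \<open>-a - T\<close>, because
  \<open>YW u m\<close> multiplies \<open>x^(-m/T - 1)\<close>.\<close>

definition prod_coef :: "'v \<Rightarrow> 'v \<Rightarrow> 'w \<Rightarrow> int \<Rightarrow> int \<Rightarrow> 'w" where
  "prod_coef u v w a b = YW u (- a - int T) (YW v (- b - int T) w)"

definition iter_coef :: "'v \<Rightarrow> 'v \<Rightarrow> 'w \<Rightarrow> int \<Rightarrow> int \<Rightarrow> 'w" where
  "iter_coef u v w d n = YW (Y u n v) (- d - int T) w"

lemma hom_left: "module_hom sc scW (\<lambda>v. YW v m w)"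
  using tw by (simp add: twisted_phi_module_def linear_iff_module_hom)

lemma hom_right: "module_hom scW scW (YW v m)"
  using tw by (simp add: twisted_phi_module_def linear_iff_module_hom)

lemmas YW_add_left = module_hom.add[OF hom_left]
  and YW_scale_left = module_hom.scale[OF hom_left]
  and YW_sum_left = module_hom.sum[OF hom_left]
  and YW_zero_left = module_hom.zero[OF hom_left]
  and YW_add_right = module_hom.add[OF hom_right]
  and YW_scale_right = module_hom.scale[OF hom_right]
  and YW_zero_right = module_hom.zero[OF hom_right]

lemma Y_truncated: obtains M where "\<And>n. n \<ge> M \<Longrightarrow> Y u n v = 0"
proof -
  have "\<exists>M. \<forall>n\<ge>M. Y u n v = 0"
    using va unfolding vertex_algebra_def by (elim conjE) blast
  with that show thesis by blast
qed

lemma YW_truncated: obtains M where "\<And>m. m \<ge> M \<Longrightarrow> YW v m w = 0"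
proof -
  have "\<exists>M. \<forall>m\<ge>M. YW v m w = 0"
    using tw unfolding twisted_phi_module_def by (elim conjE) blast
  with that show thesis by blast
qed

lemma YW_vac: "YW vac m w = (if m = - int T then w else 0)"
  using tw by (simp add: twisted_phi_module_def)

lemma iter_coef_truncated: "\<exists>M. \<forall>n\<ge>M. iter_coef u v w d n = 0"
  using Y_truncated[of u v] by (metis iter_coef_def YW_zero_left)

lemma phi_assoc_ex: "\<exists>k. \<forall>w. W.phi_assoc T k (prod_coef u v w) (iter_coef u v w)"
proof -
  obtain k where k: "\<And>w.
        (\<exists>N. \<forall>a b. (a < N \<or> b < N) \<longrightarrow> W.qcoef T (prod_coef u v w) k a b = 0) \<and>
            (\<forall>(m::int) (c::int).
               supp_sum (\<lambda>n::int. scW (if m + n + 1 \<ge> 0 then expm1_pow_coeff k (nat (m + n + 1)) else 0)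
                                      (YW (Y u n v) (int T * int k - c - int T) w))
             = (if m < 0 then 0 else
                  supp_sum (\<lambda>a::int. scW ((of_int a / of_nat T) ^ nat m / fact (nat m))
                    (W.qcoef T (prod_coef u v w) k a (c - a)))))"
    using tw unfolding twisted_phi_module_def Let_def W.qcoef_def prod_coef_def by meson
  have "W.phi_assoc T k (prod_coef u v w) (iter_coef u v w)" for w
  proof -
    obtain N where N: "\<And>a b. a < N \<or> b < N \<Longrightarrow> W.qcoef T (prod_coef u v w) k a b = 0"
      using k[of w] by blast
    show ?thesis
    proof (rule W.phi_assocI[where N = N])
      \<comment> \<open>The factor \<open>x2^k\<close> shifts the degree: total exponent
        \<open>c\<close> belongs to iterate exponent \<open>c - T k\<close>.\<close>
      have "iter_coef u v w (c - int T * int k) n = YW (Y u n v) (int T * int k - c - int T) w" for c n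
        by (simp add: iter_coef_def)
      then show "supp_sum (\<lambda>n. scW (if m + n + 1 \<ge> 0 then expm1_pow_coeff k (nat (m + n + 1)) else 0)
              (iter_coef u v w (c - int T * int k) n))
        = (if m < 0 then 0 else
            supp_sum (\<lambda>a. scW ((of_int a / of_nat T) ^ nat m / fact (nat m))
              (W.qcoef T (prod_coef u v w) k a (c - a))))" for m c
        using k[of w] by simp
    qed (use N iter_coef_truncated in auto)
  qed
  then show ?thesis by blast
qed

lemma phi_assoc_common:
  obtains k where "\<And>w. W.phi_assoc T k (prod_coef u v w) (iter_coef u v w)"
    and "\<And>w. W.phi_assoc T k (prod_coef v u w) (iter_coef v u w)"
proof -
  obtain k1 where k1: "\<And>w. W.phi_assoc T k1 (prod_coef u v w) (iter_coef u v w)"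
    using phi_assoc_ex[of u v] by blast
  obtain k2 where k2: "\<And>w. W.phi_assoc T k2 (prod_coef v u w) (iter_coef v u w)"
    using phi_assoc_ex[of v u] by blast
  show thesis
    by (rule that[of "k1 + k2"]; rule W.phi_assoc_mono[OF _ T]) (use k1 k2 in auto)
qed

text \<open>With the vacuum on the right the product is a series in \<open>x1\<close> alone. In
  generating form, \<open>Y_W(e^(xD) z, x2) = Y_W(z, x2 e^x)\<close>.\<close>

lemma YW_creation:
  "YW (Y z (- 1 - int i) vac) (- d - int T) w = scW ((of_int d / of_nat T) ^ i / fact i) (YW z (- d - int T) w)"
proof -
  obtain k where k: "W.phi_assoc T k (prod_coef z vac w) (iter_coef z vac w)"
    using phi_assoc_ex by blast
  obtain M where M: "\<And>m. m \<ge> M \<Longrightarrow> YW z m w = 0" using YW_truncated by blast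
  have "iter_coef z vac w d (- 1 - int i) = scW ((of_int d / of_nat T) ^ i / fact i) (YW z (- d - int T) w)"
    by (rule W.phi_assoc_creation[OF k T, where N = "- M - int T"])
       (auto simp: prod_coef_def YW_vac YW_zero_right intro!: M)
  then show ?thesis by (simp add: iter_coef_def)
qed

text \<open>Skew symmetry pushed through \<open>YW\<close>: on the coefficient of
  \<open>x2^(d/T)\<close>, \<open>D\<close> acts as the scalar \<open>d/T\<close>.\<close>

lemma iter_coef_skew:
  "iter_coef v u w d l = supp_sum (\<lambda>i::nat. scW ((-1) powi (l + int i + 1) * ((of_int d / of_nat T) ^ i / fact i))
     (iter_coef u v w d (l + int i)))"
proof -
  obtain M where M: "\<And>n. n \<ge> M \<Longrightarrow> Y u n v = 0" using Y_truncated by blast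
  have V: "module sc"
    using va by (simp add: vertex_algebra_def vector_space_def module_def)
  have "module_hom sc sc (\<lambda>a. Y a n b)" for n b
    using va by (simp add: vertex_algebra_def linear_iff_module_hom)
  hence Y0: "Y 0 n b = 0" for n b by (rule module_hom.zero)
  have "Y v l u = (\<Sum>i<nat (M - l). sc ((-1) powi (l + int i + 1)) (Y (Y u (l + int i) v) (- 1 - int i) vac))"
    unfolding vertex_algebra_skew_symmetry[OF va, of v l u]
    by (rule supp_sum_eq_sum) (use M in \<open>auto simp: Y0 module.scale_zero_right[OF V]\<close>)
  hence "iter_coef v u w d l = (\<Sum>i<nat (M - l). scW ((-1) powi (l + int i + 1) * ((of_int d / of_nat T) ^ i / fact i))
     (iter_coef u v w d (l + int i)))"
    by (simp add: iter_coef_def YW_sum_left YW_scale_left YW_creation)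
  also have "\<dots> = supp_sum (\<lambda>i::nat. scW ((-1) powi (l + int i + 1) * ((of_int d / of_nat T) ^ i / fact i))
     (iter_coef u v w d (l + int i)))"
    by (rule supp_sum_eq_sum[symmetric]) (use M in \<open>auto simp: iter_coef_def YW_zero_left\<close>)
  finally show ?thesis .
qed

section \<open>Invariance of the space killed by low modes\<close>

lemma Omega_tilde_iff:
  "w \<in> Omega_tilde T YW n \<longleftrightarrow> (\<forall>v b. b < - int n \<longrightarrow> YW v (- b - int T) w = 0)"
  by (simp add: Omega_tilde_def o_op_def)

lemma prod_coef_Omega_tilde:
  assumes "w \<in> Omega_tilde T YW n" "b < - int n"
  shows "prod_coef u v w a b = 0"
  using assms by (simp add: prod_coef_def Omega_tilde_iff YW_zero_right)

text \<open>Weak commutativity, which the skew symmetry of \<open>V\<close> provides, moves \<open>u\<close> next to \<open>w\<close>.\<close>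

lemma qcoef_Omega_tilde:
  assumes w: "w \<in> Omega_tilde T YW n"
    and uv: "W.phi_assoc T k (prod_coef u v w) (iter_coef u v w)"
    and vu: "W.phi_assoc T k (prod_coef v u w) (iter_coef v u w)"
    and a: "a < - int n"
  shows "W.qcoef T (prod_coef u v w) k a b = 0"
proof -
  have "W.qcoef T (prod_coef v u w) k b a = 0"
    by (rule W.qcoef_eq_0_right[OF prod_coef_Omega_tilde[OF w] a])
  moreover have "W.qcoef T (prod_coef u v w) k a b = scW ((-1) ^ k) (W.qcoef T (prod_coef v u w) k b a)"
    by (rule W.phi_assoc_skew[OF vu uv T iter_coef_skew])
  ultimately show ?thesis by simp
qed

text \<open>The coefficient at \<open>(a, 0)\<close> has total degree \<open>a < -n\<close>, where
  \<open>w\<close> kills every iterate coefficient.\<close>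

lemma Omega_tilde_invariant:
  assumes w: "w \<in> Omega_tilde T YW n"
  shows "o_op T YW 0 v w \<in> Omega_tilde T YW n"
  unfolding Omega_tilde_iff
proof (intro allI impI)
  fix u and a :: int assume a: "a < - int n"
  obtain k where k: "W.phi_assoc T k (prod_coef u v w) (iter_coef u v w)"
    using phi_assoc_ex by blast
  have "prod_coef u v w a 0 = 0"
    by (rule W.phi_assoc_eq_0_below[OF k T, of "- int n"])
       (use w a in \<open>auto simp: iter_coef_def Omega_tilde_iff prod_coef_Omega_tilde[OF w]\<close>)
  then show "YW u (- a - int T) (o_op T YW 0 v w) = 0"
    by (simp add: prod_coef_def o_op_def)
qed

lemma Omega_tilde_subspace: "module.subspace scW (Omega_tilde T YW n)"
  by (auto simp: W.subspace_def Omega_tilde_iff YW_zero_right YW_add_right YW_scale_right)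

section \<open>Action of residue products and of eigenvectors\<close>

lemma o_op_resY:
  "o_op T YW 0 (resY sc Y \<alpha> p u v) w =
     W.vpair (fls_exp (\<alpha> + 1) * (fls_exp 1 - 1) powi (- p)) (iter_coef u v w 0)"
proof -
  let ?H = "fls_exp (\<alpha> + 1) * (fls_exp 1 - 1) powi (- p)"
  obtain M where M: "\<And>n. n \<ge> M \<Longrightarrow> Y u n v = 0" using Y_truncated by blast
  have V: "module sc"
    using va by (simp add: vertex_algebra_def vector_space_def module_def)
  define L where "L = fls_subdegree ?H"
  have "resY sc Y \<alpha> p u v = (\<Sum>j\<in>{L..<M}. sc (fls_nth ?H j) (Y u j v))"
    unfolding resY_def res_coeff_conv_exp
  proof (rule supp_sum_eq_sum)
    fix j assume "j \<notin> {L..<M}"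
    then show "sc (fls_nth ?H j) (Y u j v) = 0"
      using M[of j] by (cases "j < L") (auto simp: L_def module.scale_zero_left[OF V] module.scale_zero_right[OF V])
  qed simp
  hence "o_op T YW 0 (resY sc Y \<alpha> p u v) w = (\<Sum>j\<in>{L..<M}. scW (fls_nth ?H j) (iter_coef u v w 0 j))"
    by (simp add: o_op_def iter_coef_def YW_sum_left YW_scale_left)
  also have "\<dots> = W.vpair ?H (iter_coef u v w 0)"
    by (rule W.vpair_eq_sum[symmetric]) (use M in \<open>auto simp: L_def iter_coef_def YW_zero_left\<close>)
  finally show ?thesis .
qed

text \<open>Equivariance and the eigenvalue give two scalars for \<open>YW (g u) m w\<close>; these
  roots of unity differ unless \<open>m\<close> and \<open>r\<close> agree modulo
  \<open>T\<close>.\<close>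

lemma YW_eigsp:
  assumes u: "u \<in> eigsp sc g T r" and m: "\<not> int T dvd m - int r"
  shows "YW u m w = 0"
proof -
  define e where "e m = exp (- 2 * pi * \<i> * of_int m / of_nat T)" for m :: int
  have "omegaT T powi m = e m"
    unfolding omegaT_def exp_power_int e_def by (simp add: mult_ac)
  moreover have "YW (g u) m w = scW (omegaT T powi m) (YW u m w)"
    using tw by (simp add: twisted_phi_module_def)
  moreover have "YW (g u) m w = scW (e (int r)) (YW u m w)"
    using u by (simp add: eigsp_def e_def YW_scale_left)
  ultimately have "scW (e m - e (int r)) (YW u m w) = 0"
    by (metis W.scale_left_diff_distrib right_minus_eq)
  moreover have "e m \<noteq> e (int r)"
  proof
    assume "e m = e (int r)"
    then obtain j :: int where j: "- 2 * pi * \<i> * of_int m / of_nat T =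
        - 2 * pi * \<i> * of_int (int r) / of_nat T + of_int (2 * j) * pi * \<i>"
      unfolding e_def exp_eq by auto
    have "(2 * pi * \<i>) * of_int (int r - m) = (2 * pi * \<i>) * (of_int (int T * j) :: complex)"
      using j T by (simp add: field_simps)
    hence "(of_int (int r - m) :: complex) = of_int (int T * j)"
      by (subst (asm) mult_cancel_left) auto
    hence "int r - m = int T * j" by (simp only: of_int_eq_iff)
    hence "m - int r = int T * (- j)" by simp
    with m show False by (metis dvd_triv_left)
  qed
  ultimately show ?thesis by simp
qed

lemma prod_coef_eigsp:
  assumes "u \<in> eigsp sc g T r" "\<not> int T dvd a + int r"
  shows "prod_coef u v w a b = 0"
  unfolding prod_coef_def
proof (rule YW_eigsp[OF assms(1)])
  have "- a - int T - int r = - (a + int r) - int T" by simp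
  then show "\<not> int T dvd - a - int T - int r"
    using assms(2) by (metis dvd_diff_right_iff dvd_minus_iff dvd_refl dvd_diff_left_iff)
qed

lemma o_op_diamond:
  assumes r: "r < T" and u: "u \<in> eigsp sc g T r" and w: "w \<in> Omega_tilde T YW n"
  shows "o_op T YW 0 (diamondg sc Y T n r u v) w = 0"
proof -
  obtain k where k: "\<And>w. W.phi_assoc T k (prod_coef u v w) (iter_coef u v w)"
      "\<And>w. W.phi_assoc T k (prod_coef v u w) (iter_coef v u w)"
    using phi_assoc_common by blast
  show ?thesis
    unfolding diamondg_def o_op_resY
    by (rule W.diamond_residue_eq_0[OF k(1) T r prod_coef_Omega_tilde[OF w]
          qcoef_Omega_tilde[OF w k(1) k(2)] prod_coef_eigsp[OF u] refl refl])
qed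

text \<open>\<open>D\<close> acts as \<open>x d/dx\<close>, which kills the coefficient of
  \<open>x^0\<close>.\<close>

lemma o_op_D: "o_op T YW 0 (Y v (- 2) vac) w = 0"
  using YW_creation[of v 1 0 w] by (simp add: o_op_def)

lemma o_op_Otilde:
  assumes w: "w \<in> Omega_tilde T YW n" and v: "v \<in> Otilde sc Y vac g T n"
  shows "o_op T YW 0 v w = 0"
proof -
  interpret V: vector_space sc using va by (simp add: vertex_algebra_def)
  have "V.subspace {v. o_op T YW 0 v w = 0}"
    by (auto simp: V.subspace_def o_op_def YW_zero_left YW_add_left YW_scale_left)
  moreover have "{diamondg sc Y T n r u v | r u v. r < T \<and> u \<in> eigsp sc g T r} \<union> {Y v (-2) vac | v. True}
      \<subseteq> {v. o_op T YW 0 v w = 0}"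
    using w by (auto simp: o_op_diamond o_op_D)
  ultimately have "Otilde sc Y vac g T n \<subseteq> {v. o_op T YW 0 v w = 0}"
    unfolding Otilde_def by (intro V.span_minimal)
  with v show ?thesis by blast
qed

lemma o_op_bullet:
  assumes r: "r < T" and u: "u \<in> eigsp sc g T r" and w: "w \<in> Omega_tilde T YW n"
  shows "o_op T YW 0 (bulletg sc Y T n r u v) w = o_op T YW 0 u (o_op T YW 0 v w)"
proof -
  have uv: "o_op T YW 0 u (o_op T YW 0 v w) = prod_coef u v w 0 0"
    by (simp add: o_op_def prod_coef_def)
  show ?thesis
  proof (cases "r = 0")
    case True
    obtain k where k: "\<And>w. W.phi_assoc T k (prod_coef u v w) (iter_coef u v w)"
        "\<And>w. W.phi_assoc T k (prod_coef v u w) (iter_coef v u w)"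
      using phi_assoc_common by blast
    have "o_op T YW 0 (bulletg sc Y T n r u v) w =
      (\<Sum>i\<le>n div T. scW ((-1) ^ i * of_nat ((n div T + i) choose i))
        (W.vpair (fls_exp (of_nat (n div T) + 1) * (fls_exp 1 - 1) powi (- (int (n div T) + int i + 1)))
          (iter_coef u v w 0)))"
      unfolding o_op_resY[symmetric] using T
      by (simp add: bulletg_def True deltaT_def o_op_def YW_sum_left YW_scale_left)
    also have "\<dots> = prod_coef u v w 0 0"
      by (rule W.bullet_residue_sum[OF k(1) T prod_coef_Omega_tilde[OF w]
            qcoef_Omega_tilde[OF w k(1) k(2)]])
         (use prod_coef_eigsp[OF u] True in auto)
    finally show ?thesis by (simp add: uv)
  next
    case False
    \<comment> \<open>For \<open>r \<noteq> 0\<close> the field of \<open>u\<close> has no integral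
      exponents, so both sides vanish.\<close>
    have "\<not> int T dvd 0 + int r" using False r by (auto dest: zdvd_imp_le)
    hence "prod_coef u v w 0 0 = 0" by (rule prod_coef_eigsp[OF u])
    then show ?thesis
      using False by (simp add: uv) (simp add: bulletg_def o_op_def YW_zero_left)
  qed
qed

end

theorem theorem4p3:
  fixes sc :: "complex \<Rightarrow> 'v::ab_group_add \<Rightarrow> 'v"
    and Y :: "'v \<Rightarrow> int \<Rightarrow> 'v \<Rightarrow> 'v" and vac :: 'v and g :: "'v \<Rightarrow> 'v" and T :: nat
    and scW :: "complex \<Rightarrow> 'w::ab_group_add \<Rightarrow> 'w" and YW :: "'v \<Rightarrow> int \<Rightarrow> 'w \<Rightarrow> 'w"
    and nn :: nat
  assumes "vertex_algebra sc Y vac"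
    and "va_automorphism sc Y vac g"
    and "T > 0" and "g ^^ T = id" and "\<forall>k. 0 < k \<and> k < T \<longrightarrow> g ^^ k \<noteq> id"
    and "twisted_phi_module sc Y vac g T scW YW"
  shows "(\<forall>v. \<forall>w\<in>Omega_tilde T YW nn. o_op T YW 0 v w \<in> Omega_tilde T YW nn)
       \<and> module.subspace scW (Omega_tilde T YW nn)
       \<and> (\<forall>v\<in>Otilde sc Y vac g T nn. \<forall>w\<in>Omega_tilde T YW nn. o_op T YW 0 v w = 0)
       \<and> (\<forall>w\<in>Omega_tilde T YW nn. o_op T YW 0 vac w = w)
       \<and> (\<forall>r<T. \<forall>u\<in>eigsp sc g T r. \<forall>v. \<forall>w\<in>Omega_tilde T YW nn.
             o_op T YW 0 (bulletg sc Y T nn r u v) w = o_op T YW 0 u (o_op T YW 0 v w))"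
proof -
  interpret twisted_module sc Y vac g T scW YW
    using assms
    by (simp add: twisted_module_def twisted_module_axioms_def complex_vector_space_def
        twisted_phi_module_def)
  show ?thesis
    using Omega_tilde_invariant Omega_tilde_subspace o_op_Otilde o_op_bullet
    by (auto simp: o_op_def YW_vac)
qed

end
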